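(* Let $X$ be the complex $K3$ surface with transcendental lattice $\langle 6\rangle\oplus\langle 2\rangle$, and consider the elliptic fibration on $X$ associated with the primitive embedding of $A_5\oplus A_1$ in $L=N(A_9^2D_6)$ given by $A_1=\langle a_1\rangle\subset A_9^{(1)}$ and $A_5$ embedded in $D_6$ as $i_1(A_5)=(d_5,d_4,d_3,d_2,d_1)$. Let $W$ and $N$ be the orthogonal complements of the image of $A_5\oplus A_1$ in $L$ and in $L_{\rm root}$, and let $V_1,\dots,V_9,V_{11},V_{12}$ be the sections defined in the context. (1) The Mordell-Weil lattice can be generated by $V_2$ and any one of the sections $V_1,V_3,V_7,V_9$ (whose classes in $W/N$ have order $10$) or $V_5$ (whose class in $W/N$ has order $2$). It can also be generated by $V_1$ and $V_3$, or by $V_1$ and $V_9$. (2) The rational quadratic forms associated to the height matrices of these various pairs of generators are all equivalent to the quadratic form $Q(x,y)=\frac1{40}(61x^2+4xy+4y^2)$. (3) The sublattice $N/N_{\rm root}$, which has index $10$ in $W/N_{\rm root}$, is generated by $V_{11}=-5V_2$ and $V_{12}$, with $\langle V_{11},V_{12}\rangle=0$.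
   Context: Root lattices are negative definite (roots have square $-2$). $a_1,\dots,a_9$ are the simple roots of $A_9$ (consecutive ones joined), $d_1,\dots,d_6$ those of $D_6$ in Bourbaki numbering: chain $d_1-d_2-d_3-d_4$, with $d_5,d_6$ both joined to $d_4$. An embedding $(d_{j_1},\dots,d_{j_5})$ sends the consecutive simple roots of $A_5$ to the listed roots. Let $\alpha=\frac1{10}(9a_1+8a_2+7a_3+6a_4+5a_5+4a_6+3a_7+2a_8+a_9)$, write $i$ for the class of $i\alpha$ in $A_9^*/A_9$, and in $D_6^*/D_6$ write $[1]$, $[3]$ for the classes of $\delta_6=\frac12(d_1+2d_2+3d_3+4d_4+2d_5+3d_6)$ and $\tilde\delta_6=\frac12(d_1+2d_2+3d_3+4d_4+3d_5+2d_6)$. The Niemeier lattice $L=N(A_9^2D_6)$ is generated in $(A_9^* )^2\oplus D_6^*$ by $L_{\rm root}=A_9^{(1)}\oplus A_9^{(2)}\oplus D_6$ and the cosets $[2,4,0],[5,0,1],[0,5,3]$. With $W=(A_5\oplus A_1)^{\perp_L}$ and $N=(A_5\oplus A_1)^{\perp_{L_{\rm root}}}$ one has $W_{\rm root}=N_{\rm root}$ (sublattices generated by vectors of square $-2$), here equal to $\langle a_3,\dots,a_9\rangle\oplus A_9^{(2)}\simeq A_7\oplus A_9$, and it is primitive in $W$. $W$ is the frame of the associated elliptic fibration on $X$: $NS(X)\simeq U\oplus W$, with $U$ generated by the fiber class $F$ and the zero section $O$ ($F^2=0$, $O^2=-2$, $F\cdot O=1$). The Mordell-Weil group is $W/W_{\rm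 root}$ (torsion-free here), a section of class $O+kF+\omega$ with $\omega\in W$ corresponding to the class of $\omega$. The Mordell-Weil lattice is $W/W_{\rm root}$ with the height pairing $\langle\cdot,\cdot\rangle$, i.e. minus the bilinear form of the orthogonal projections to $(W_{\rm root})^\perp\otimes\mathbb Q$ (Shioda's height pairing). Relations between sections are relations in the Mordell-Weil group; equivalence of quadratic forms is under $GL_2(\mathbb Z)$. The class of a section in $W/N$ is the class of $\omega$. Let $\alpha_j\in A_9^*$ ($1\le j\le 9$) be the dual basis: $\alpha_j\cdot a_j=1$, $\alpha_j\cdot a_i=0$ for $i\ne j$ (so $-\alpha_j=j\alpha-(j-1)a_1-\dots-a_{j-1}$). In a triple $[x,y,z]$ the entries lie in $(A_9^{(1)})^*,(A_9^{(2)})^*,D_6^*$. The sections are: $V_1=O+2F+[\alpha_9,\alpha_8,\delta_6]$, $V_2=O+2F+[\alpha_8,\alpha_6,0]$, $V_3=O+3F+[\alpha_7,\alpha_4,\delta_6]$, $V_4=O+2F+[\alpha_6,\alpha_2,0]$, $V_5=O+2F+[\alpha_5,0,\delta_6]$, $V_6=O+2F+[\alpha_4,\alpha_8,0]$, $V_7=O+3F+[\alpha_3,\alpha_6,\delta_6]$, $V_8=O+2F+[\alpha_2,\alpha_4,0]$, $V_9=O+2F+[\alpha_1+a_1+a_2,\alpha_2,\delta_6]$, $V_{11}=O+2F+[a_1+2a_2+a_3,0,0]$, $V_{12}=O+3F+[0,0,2\delta_6]$. *)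

theory Defs
  imports
    "HOL-Analysis.Cartesian_Space"
    "HOL-Algebra.Multiplicative_Group"
    "HOL-Algebra.Generated_Groups"
    "HOL-Computational_Algebra.Group_Closure"
    "HOL-Library.Function_Algebras"
begin

section \<open>Root lattices and the Niemeier lattice\<close>

text \<open>An element of the rational span of a root lattice of rank \<open>n\<close> is given by its coefficients
  with respect to the simple roots, which are indexed by \<open>1, \<dots>, n\<close>.  All coefficient functions
  below vanish outside this range.\<close>

type_synonym coords = "nat \<Rightarrow> rat"

definition sroot :: "nat \<Rightarrow> coords" where
  "sroot i = (\<lambda>j. if j = i then 1 else 0)"

definition coords_of :: "rat list \<Rightarrow> coords" where
  "coords_of cs = (\<lambda>i. if 1 \<le> i \<and> i \<le> length cs then cs ! (i - 1) else 0)"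

definition smul :: "rat \<Rightarrow> coords \<Rightarrow> coords" where
  "smul c x = (\<lambda>i. c * x i)"

definition root_lattice :: "nat \<Rightarrow> coords set" where
  "root_lattice n = group_closure (sroot ` {1..n})"

definition dynkin_form :: "nat \<Rightarrow> (nat \<Rightarrow> nat \<Rightarrow> bool) \<Rightarrow> coords \<Rightarrow> coords \<Rightarrow> rat" where
  "dynkin_form n joined x y =
     (\<Sum>i=1..n. \<Sum>j=1..n. x i * y j * (if i = j then - 2 else if joined i j then 1 else 0))"

definition joined_A :: "nat \<Rightarrow> nat \<Rightarrow> bool" where
  "joined_A i j \<longleftrightarrow> j = i + 1 \<or> i = j + 1"

definition joined_D6 :: "nat \<Rightarrow> nat \<Rightarrow> bool" where
  "joined_D6 i j \<longleftrightarrow> {i, j} \<in> {{1, 2}, {2, 3}, {3, 4}, {4, 5}, {4, 6}}"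

definition form_A :: "nat \<Rightarrow> coords \<Rightarrow> coords \<Rightarrow> rat" where
  "form_A n = dynkin_form n joined_A"

definition form_D6 :: "coords \<Rightarrow> coords \<Rightarrow> rat" where
  "form_D6 = dynkin_form 6 joined_D6"

text \<open>Vectors of the rational span of \<open>A\<^sub>9\<^sup>(\<^sup>1\<^sup>) \<oplus> A\<^sub>9\<^sup>(\<^sup>2\<^sup>) \<oplus> D\<^sub>6\<close>.\<close>

type_synonym vec3 = "coords \<times> coords \<times> coords"

fun qscale :: "rat \<Rightarrow> vec3 \<Rightarrow> vec3" where
  "qscale c (x, y, z) = (smul c x, smul c y, smul c z)"

fun bform :: "vec3 \<Rightarrow> vec3 \<Rightarrow> rat" where
  "bform (x, y, z) (x', y', z') = form_A 9 x x' + form_A 9 y y' + form_D6 z z'"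

definition qspan :: "vec3 set \<Rightarrow> vec3 set" where
  "qspan S = module.span qscale S"

definition alpha :: coords where
  "alpha = smul (1/10) (coords_of [9, 8, 7, 6, 5, 4, 3, 2, 1])"

definition delta6 :: coords where
  "delta6 = smul (1/2) (coords_of [1, 2, 3, 4, 2, 3])"

definition delta6' :: coords where
  "delta6' = smul (1/2) (coords_of [1, 2, 3, 4, 3, 2])"

definition L_root :: "vec3 set" where
  "L_root = root_lattice 9 \<times> root_lattice 9 \<times> root_lattice 6"

text \<open>Since \<open>L_root\<close> is among the generators, each glue coset is given by one representative,
  \<open>delta6\<close> and \<open>delta6'\<close> representing the classes \<open>[1]\<close> and \<open>[3]\<close> of \<open>D\<^sub>6\<close>.\<close>

definition L :: "vec3 set" where
  "L = group_closure (L_root \<union>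
     {(smul 2 alpha, smul 4 alpha, 0), (smul 5 alpha, 0, delta6), (0, smul 5 alpha, delta6')})"

definition alpha_dual :: "nat \<Rightarrow> coords" where
  "alpha_dual j = (THE x. (\<forall>i. i \<notin> {1..9} \<longrightarrow> x i = 0) \<and>
     (\<forall>i\<in>{1..9}. form_A 9 x (sroot i) = (if i = j then 1 else 0)))"


section \<open>The embedding of \<open>A\<^sub>5 \<oplus> A\<^sub>1\<close> and its orthogonal complements\<close>

text \<open>The \<open>i\<close>-th simple root of \<open>A\<^sub>5\<close> goes to \<open>d\<^sub>6\<^sub>-\<^sub>i\<close>, that of \<open>A\<^sub>1\<close> to \<open>a\<^sub>1\<close> in the first
  copy of \<open>A\<^sub>9\<close>.\<close>

definition A5_A1 :: "(coords \<times> coords) set" where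
  "A5_A1 = root_lattice 5 \<times> root_lattice 1"

fun emb :: "coords \<times> coords \<Rightarrow> vec3" where
  "emb (x, y) = (smul (y 1) (sroot 1), 0,
     smul (x 1) (sroot 5) + smul (x 2) (sroot 4) + smul (x 3) (sroot 3)
       + smul (x 4) (sroot 2) + smul (x 5) (sroot 1))"

definition orth_compl :: "vec3 set \<Rightarrow> vec3 set \<Rightarrow> vec3 set" where
  "orth_compl S M = {x \<in> M. \<forall>y\<in>S. bform x y = 0}"

definition W :: "vec3 set" where
  "W = orth_compl (emb ` A5_A1) L"

definition N :: "vec3 set" where
  "N = orth_compl (emb ` A5_A1) L_root"

definition root_sublattice :: "vec3 set \<Rightarrow> vec3 set" where
  "root_sublattice M = group_closure {x \<in> M. bform x x = - 2}"

abbreviation W_root :: "vec3 set" where "W_root \<equiv> root_sublattice W"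
abbreviation N_root :: "vec3 set" where "N_root \<equiv> root_sublattice N"


section \<open>Neron-Severi classes, Mordell-Weil group and height pairing\<close>

text \<open>The triple \<open>(m, k, \<omega>)\<close> stands for the class \<open>m O + k F + \<omega>\<close> in \<open>U \<oplus> W\<close>.\<close>

type_synonym ns_class = "int \<times> int \<times> vec3"

definition NS :: "ns_class set" where
  "NS = {(m, k, w). w \<in> W}"

fun ns_form :: "ns_class \<Rightarrow> ns_class \<Rightarrow> rat" where
  "ns_form (m, k, w) (m', k', w') = of_int (- 2 * m * m' + m * k' + k * m') + bform w w'"

definition fiber :: ns_class where "fiber = (0, 1, 0)"

text \<open>The class \<open>O + k F + \<omega>\<close>; its Mordell-Weil class \<open>mw\<close> below is that of \<open>\<omega>\<close> modulo
  \<open>W_root\<close>.\<close>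

definition section_class :: "int \<Rightarrow> vec3 \<Rightarrow> ns_class" where
  "section_class k w = (1, k, w)"

definition frame_part :: "ns_class \<Rightarrow> vec3" where
  "frame_part S = snd (snd S)"

definition add_grp :: "vec3 set \<Rightarrow> vec3 monoid" where
  "add_grp M = \<lparr>carrier = M, monoid.mult = (+), one = 0\<rparr>"

definition quot :: "vec3 set \<Rightarrow> vec3 set \<Rightarrow> vec3 set monoid" where
  "quot M K = add_grp M Mod K"

definition coset :: "vec3 set \<Rightarrow> vec3 set \<Rightarrow> vec3 \<Rightarrow> vec3 set" where
  "coset M K x = K #>\<^bsub>add_grp M\<^esub> x"

definition MW :: "vec3 set monoid" where
  "MW = quot W W_root"

definition mw :: "ns_class \<Rightarrow> vec3 set" where
  "mw S = coset W W_root (frame_part S)"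

definition proj :: "vec3 \<Rightarrow> vec3" where
  "proj w = (THE p. p \<in> qspan W \<and> (\<forall>r\<in>W_root. bform p r = 0) \<and> w - p \<in> qspan W_root)"

text \<open>The value on representatives is independent of their choice, so that the set below is a
  singleton.\<close>

definition height_pairing :: "vec3 set \<Rightarrow> vec3 set \<Rightarrow> rat" where
  "height_pairing X Y = the_elem {- bform (proj v) (proj w) | v w. v \<in> X \<and> w \<in> Y}"

definition height_matrix :: "ns_class \<Rightarrow> ns_class \<Rightarrow> rat^2^2" where
  "height_matrix P R = vector
     [vector [height_pairing (mw P) (mw P), height_pairing (mw P) (mw R)],
      vector [height_pairing (mw R) (mw P), height_pairing (mw R) (mw R)]]"

definition quadratic_form :: "rat^2^2 \<Rightarrow> rat^2 \<Rightarrow> rat" where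
  "quadratic_form H v = (\<Sum>i\<in>UNIV. \<Sum>j\<in>UNIV. v $ i * H $ i $ j * v $ j)"

text \<open>\<open>invertible\<close> is meant over the integers here, that is, \<open>M\<close> ranges over \<open>GL\<^sub>2\<close> of the integers.\<close>

definition GL2Z_equivalent :: "(rat^2 \<Rightarrow> rat) \<Rightarrow> (rat^2 \<Rightarrow> rat) \<Rightarrow> bool" where
  "GL2Z_equivalent q q' \<longleftrightarrow>
     (\<exists>M :: int^2^2. invertible M \<and> (\<forall>v. q' v = q (map_matrix rat_of_int M *v v)))"

definition form_Q :: "rat^2 \<Rightarrow> rat" where
  "form_Q v = 1/40 * (61 * (v $ 1)^2 + 4 * (v $ 1) * (v $ 2) + 4 * (v $ 2)^2)"


section \<open>The sections\<close>

definition "V1 = section_class 2 (alpha_dual 9, alpha_dual 8, delta6)"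
definition "V2 = section_class 2 (alpha_dual 8, alpha_dual 6, 0)"
definition "V3 = section_class 3 (alpha_dual 7, alpha_dual 4, delta6)"
definition "V4 = section_class 2 (alpha_dual 6, alpha_dual 2, 0)"
definition "V5 = section_class 2 (alpha_dual 5, 0, delta6)"
definition "V6 = section_class 2 (alpha_dual 4, alpha_dual 8, 0)"
definition "V7 = section_class 3 (alpha_dual 3, alpha_dual 6, delta6)"
definition "V8 = section_class 2 (alpha_dual 2, alpha_dual 4, 0)"
definition "V9 = section_class 2 (alpha_dual 1 + sroot 1 + sroot 2, alpha_dual 2, delta6)"
definition "V11 = section_class 2 (sroot 1 + smul 2 (sroot 2) + sroot 3, 0, 0)"
definition "V12 = section_class 3 (0, 0, smul 2 delta6)"

section \<open>The dual basis, the glue, primitivity of the embedding, and the sections as classes in \<open>NS\<close>\<close>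

lemma vector_space_qscale: "vector_space qscale"
  by unfold_locales (auto simp: smul_def fun_eq_iff algebra_simps)

lemma root_lattice_iff:
  "x \<in> root_lattice n \<longleftrightarrow> (\<forall>i. x i \<in> \<int>) \<and> (\<forall>i. i \<notin> {1..n} \<longrightarrow> x i = 0)"
proof
  assume "x \<in> root_lattice n"
  then show "(\<forall>i. x i \<in> \<int>) \<and> (\<forall>i. i \<notin> {1..n} \<longrightarrow> x i = 0)"
    unfolding root_lattice_def
    by (induction rule: group_closure.induct) (auto simp: sroot_def)
next
  assume x: "(\<forall>i. x i \<in> \<int>) \<and> (\<forall>i. i \<notin> {1..n} \<longrightarrow> x i = 0)"
  have nat_mult: "smul (of_nat k) (sroot i) \<in> root_lattice n" if "i \<in> {1..n}" for i k
  proof (induction k)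
    case 0
    have "smul (of_nat 0) (sroot i) = 0" by (simp add: smul_def fun_eq_iff)
    then show ?case unfolding root_lattice_def by (metis zero_in_group_closure)
  next
    case (Suc k)
    have eq: "smul (of_nat (Suc k)) (sroot i) = smul (of_nat k) (sroot i) + sroot i"
      by (simp add: smul_def fun_eq_iff algebra_simps)
    have "sroot i \<in> root_lattice n"
      using that unfolding root_lattice_def by (auto intro: group_closure.base)
    with Suc show ?case unfolding eq root_lattice_def by (intro group_closure_add)
  qed
  have int_mult: "smul c (sroot i) \<in> root_lattice n" if "i \<in> {1..n}" "c \<in> \<int>" for i c
  proof -
    from \<open>c \<in> \<int>\<close> obtain m where m: "c = of_int m" by (auto elim: Ints_cases)
    show ?thesis
    proof (cases "m \<ge> 0")
      case True
      then have "c = of_nat (nat m)" using m by simp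
      then show ?thesis using nat_mult[OF that(1)] by simp
    next
      case False
      then have "smul c (sroot i) = - smul (of_nat (nat (- m))) (sroot i)"
        using m by (simp add: smul_def fun_eq_iff)
      then show ?thesis using nat_mult[OF that(1), of "nat (- m)"]
        unfolding root_lattice_def by (metis group_closure_minus_iff)
    qed
  qed
  have sum_mem: "(\<Sum>i\<in>B. smul (x i) (sroot i)) \<in> root_lattice n" if "finite B" "B \<subseteq> {1..n}" for B
    using that
  proof (induction B rule: finite_induct)
    case empty
    show ?case unfolding sum.empty root_lattice_def by (rule zero_in_group_closure)
  next
    case (insert b B)
    then have "smul (x b) (sroot b) \<in> root_lattice n" "(\<Sum>i\<in>B. smul (x i) (sroot i)) \<in> root_lattice n"
      using x int_mult by auto
    then show ?case unfolding sum.insert[OF insert(1,2)] root_lattice_def by (rule group_closure_add)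
  qed
  have sum_app: "(\<Sum>i\<in>B. f i) j = (\<Sum>i\<in>B. f i j)" if "finite B" for B j and f :: "nat \<Rightarrow> coords"
    using that by (induction B rule: finite_induct) auto
  have "x j = (\<Sum>i\<in>{1..n}. smul (x i) (sroot i)) j" for j
  proof -
    have "(\<Sum>i\<in>{1..n}. smul (x i) (sroot i)) j = (\<Sum>i\<in>{1..n}. if i = j then x i else 0)"
      unfolding sum_app[OF finite_atLeastAtMost]
      by (rule sum.cong) (simp_all add: smul_def sroot_def)
    also have "\<dots> = x j" using x by (simp add: sum.delta)
    finally show ?thesis by simp
  qed
  then have "x = (\<Sum>i\<in>{1..n}. smul (x i) (sroot i))" by blast
  with sum_mem[of "{1..n}"] show "x \<in> root_lattice n" by simp
qed

lemma one_to_nine: "{1..9::nat} = {1, 2, 3, 4, 5, 6, 7, 8, 9}" and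
  one_to_six: "{1..6::nat} = {1, 2, 3, 4, 5, 6}"
  by auto

lemma form_A9_eq:
  "form_A 9 x y =
     - 2 * x 1 * y 1 + - 2 * x 2 * y 2 + - 2 * x 3 * y 3 + - 2 * x 4 * y 4 + - 2 * x 5 * y 5
     + - 2 * x 6 * y 6 + - 2 * x 7 * y 7 + - 2 * x 8 * y 8 + - 2 * x 9 * y 9 + x 1 * y 2 + x
     2 * y 1 + x 2 * y 3 + x 3 * y 2 + x 3 * y 4 + x 4 * y 3 + x 4 * y 5 + x 5 * y 4 + x 5 *
     y 6 + x 6 * y 5 + x 6 * y 7 + x 7 * y 6 + x 7 * y 8 + x 8 * y 7 + x 8 * y 9 + x 9 * y 8"
  unfolding form_A_def dynkin_form_def one_to_nine
  by (simp add: joined_A_def)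

lemma form_D6_eq:
  "form_D6 x y =
     - 2 * x 1 * y 1 + - 2 * x 2 * y 2 + - 2 * x 3 * y 3 + - 2 * x 4 * y 4 + - 2 * x 5 * y 5
     + - 2 * x 6 * y 6 + x 1 * y 2 + x 2 * y 1 + x 2 * y 3 + x 3 * y 2 + x 3 * y 4 + x 4 * y
     3 + x 4 * y 5 + x 5 * y 4 + x 4 * y 6 + x 6 * y 4"
  unfolding form_D6_def dynkin_form_def one_to_six
  by (simp add: joined_D6_def doubleton_eq_iff)

lemma alpha_dual_eq:
  assumes "j \<in> {1..9}"
  shows "alpha_dual j = (\<lambda>i. if i \<in> {1..9}
           then - of_nat (min i j * (10 - max i j)) / 10 else 0)" (is "_ = ?f")
  unfolding alpha_dual_def
proof (rule the_equality)
  have "j \<in> {1, 2, 3, 4, 5, 6, 7, 8, 9}" using assms one_to_nine by blast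
  then show f: "(\<forall>i. i \<notin> {1..9} \<longrightarrow> ?f i = 0) \<and>
    (\<forall>i\<in>{1..9}. form_A 9 ?f (sroot i) = (if i = j then 1 else 0))"
    unfolding form_A9_eq one_to_nine by (elim insertE) (simp_all add: sroot_def)
  fix x :: coords
  assume x: "(\<forall>i. i \<notin> {1..9} \<longrightarrow> x i = 0) \<and>
    (\<forall>i\<in>{1..9}. form_A 9 x (sroot i) = (if i = j then 1 else 0))"
  define u where "u = x - ?f"
  have "form_A 9 u (sroot i) = 0" if "i \<in> {1..9}" for i
  proof -
    have "form_A 9 u (sroot i) = form_A 9 x (sroot i) - form_A 9 ?f (sroot i)"
      unfolding u_def form_A9_eq by (simp add: algebra_simps)
    then show ?thesis using f x that by simp
  qed
  then have "\<forall>i\<in>{1, 2, 3, 4, 5, 6, 7, 8, 9}. form_A 9 u (sroot i) = 0"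
    using one_to_nine by blast
  then have "u 1 = 0 \<and> u 2 = 0 \<and> u 3 = 0 \<and> u 4 = 0 \<and> u 5 = 0 \<and> u 6 = 0 \<and> u 7 = 0 \<and> u 8 = 0 \<and> u 9 = 0"
    unfolding form_A9_eq by (simp add: sroot_def)
  then have "\<forall>i\<in>{1..9}. u i = 0" unfolding one_to_nine by simp
  moreover have "\<forall>i. i \<notin> {1..9} \<longrightarrow> u i = 0" unfolding u_def using f x by simp
  ultimately have "\<forall>i. u i = 0" by blast
  then show "x = ?f" unfolding u_def by (simp add: fun_eq_iff)
qed

lemma group_closure_qscale:
  assumes "v \<in> group_closure S"
  shows "qscale (of_int m) v \<in> group_closure S"
proof -
  have nat: "qscale (of_nat k) v \<in> group_closure S" for k
  proof (induction k)
    case 0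
    have "qscale (of_nat 0) v = 0" by (cases v) (simp add: smul_def fun_eq_iff zero_prod_def)
    then show ?case by (metis zero_in_group_closure)
  next
    case (Suc k)
    have "qscale (of_nat (Suc k)) v = qscale (of_nat k) v + v"
      by (cases v) (simp add: smul_def fun_eq_iff algebra_simps)
    then show ?case using group_closure_add[OF Suc assms] by metis
  qed
  show ?thesis
  proof (cases "m \<ge> 0")
    case True
    then have "of_int m = (of_nat (nat m) :: rat)" by simp
    then show ?thesis using nat by metis
  next
    case False
    then have "m = - int (nat (- m))" by simp
    then obtain k where k: "m = - int k" by blast
    have "qscale (of_int m) v = - qscale (of_nat k) v"
      unfolding k by (cases v) (simp add: smul_def fun_eq_iff)
    then show ?thesis using nat by (metis group_closure_minus_iff)
  qed
qed

lemma L_iff: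
  "(x, y, z) \<in> L \<longleftrightarrow> (\<exists>p q r :: int.
      x - smul (of_int (2 * p + 5 * q)) alpha \<in> root_lattice 9 \<and>
      y - smul (of_int (4 * p + 5 * r)) alpha \<in> root_lattice 9 \<and>
      z - smul (of_int q) delta6 - smul (of_int r) delta6' \<in> root_lattice 6)"
  (is "_ \<longleftrightarrow> (\<exists>p q r. ?P x y z p q r)")
proof
  let ?g1 = "(smul 2 alpha, smul 4 alpha, 0 :: coords)" and ?g2 = "(smul 5 alpha, 0 :: coords, delta6)"
    and ?g3 = "(0 :: coords, smul 5 alpha, delta6')"
  let ?G = "{?g1, ?g2, ?g3}"
  {
    fix v assume "v \<in> L"
    then have "\<exists>p q r. ?P (fst v) (fst (snd v)) (snd (snd v)) p q r"
      unfolding L_def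
    proof (induction rule: group_closure.induct)
      case (base s)
      then have "s = 0 \<or> s \<in> L_root \<or> s = ?g1 \<or> s = ?g2 \<or> s = ?g3"
        by (simp only: insert_iff Un_iff empty_iff simp_thms)
      then consider "s = 0" | "s \<in> L_root" | "s = ?g1" | "s = ?g2" | "s = ?g3" by (elim disjE)
      then show ?case
      proof cases
        case 1
        show ?thesis unfolding 1 root_lattice_iff
          by (intro exI[of _ 0]) (simp add: smul_def)
      next
        case 2
        have "f - smul (of_int 0) g = f" for f g by (simp add: smul_def fun_eq_iff)
        then show ?thesis using 2 unfolding L_root_def
          by (intro exI[of _ 0]) auto
      next
        case 3
        show ?thesis unfolding 3 root_lattice_iff
          by (rule exI[of _ 1], rule exI[of _ 0], rule exI[of _ 0]) (simp add: smul_def)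
      next
        case 4
        show ?thesis unfolding 4 root_lattice_iff
          by (rule exI[of _ 0], rule exI[of _ 1], rule exI[of _ 0]) (simp add: smul_def)
      next
        case 5
        show ?thesis unfolding 5 root_lattice_iff
          by (rule exI[of _ 0], rule exI[of _ 0], rule exI[of _ 1]) (simp add: smul_def)
      qed
    next
      case (diff s t)
      then obtain p q r p' q' r' where
        st: "?P (fst s) (fst (snd s)) (snd (snd s)) p q r"
            "?P (fst t) (fst (snd t)) (snd (snd t)) p' q' r'"
        by blast
      have d: "f - g \<in> root_lattice n" if "f \<in> root_lattice n" "g \<in> root_lattice n" for f g n
        using that unfolding root_lattice_def by (rule group_closure.diff)
      have e1: "a - b - smul (of_int (k * (p - p') + 5 * (l - l'))) alpha =
          (a - smul (of_int (k * p + 5 * l)) alpha) - (b - smul (of_int (k * p' + 5 * l')) alpha)"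
        for a b k l l' by (simp add: smul_def fun_eq_iff algebra_simps)
      have e2: "a - b - smul (of_int (q - q')) delta6 - smul (of_int (r - r')) delta6' =
          (a - smul (of_int q) delta6 - smul (of_int r) delta6') -
          (b - smul (of_int q') delta6 - smul (of_int r') delta6')"
        for a b by (simp add: smul_def fun_eq_iff algebra_simps)
      have "?P (fst (s - t)) (fst (snd (s - t))) (snd (snd (s - t))) (p - p') (q - q') (r - r')"
        unfolding fst_diff snd_diff e1 e2 using st by (blast intro: d)
      then show ?case by blast
    qed
  }
  note * = this
  show "(x, y, z) \<in> L \<Longrightarrow> \<exists>p q r. ?P x y z p q r" using *[of "(x, y, z)"] by simp
  assume "\<exists>p q r. ?P x y z p q r"
  then obtain p q r where P: "?P x y z p q r" by blast
  let ?l = "(x - smul (of_int (2 * p + 5 * q)) alpha, y - smul (of_int (4 * p + 5 * r)) alpha,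
    z - smul (of_int q) delta6 - smul (of_int r) delta6')"
  have eq: "(x, y, z) = ?l + (qscale (of_int p) ?g1 + (qscale (of_int q) ?g2 + qscale (of_int r) ?g3))"
    by (simp add: smul_def fun_eq_iff algebra_simps)
  have g: "?g1 \<in> L" "?g2 \<in> L" "?g3 \<in> L"
    unfolding L_def by (rule group_closure.base, blast)+
  have l: "?l \<in> L" using P unfolding L_def L_root_def by (intro group_closure.base) blast
  show "(x, y, z) \<in> L" unfolding eq
    using g l group_closure_qscale group_closure_add unfolding L_def by metis
qed

lemma emb_isometry:
  "bform (emb (x, y)) (emb (x', y')) = form_A 5 x x' + form_A 1 y y'"
proof -
  have five: "{1..5::nat} = {1, 2, 3, 4, 5}" by auto
  have one: "{1..1::nat} = {1}" by auto
  show ?thesis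
    unfolding emb.simps bform.simps form_A9_eq form_D6_eq
    unfolding form_A_def dynkin_form_def five one
    by (simp add: joined_A_def smul_def sroot_def algebra_simps)
qed

lemma emb_primitive:
  assumes "v \<in> L" "n \<noteq> (0::int)" "qscale (of_int n) v \<in> emb ` A5_A1"
  shows "v \<in> emb ` A5_A1"
proof -
  obtain x y z where v: "v = (x, y, z)" by (cases v)
  obtain a b where ab: "qscale (of_int n) v = emb (a, b)"
    using assms(3) by (metis imageE surj_pair)
  have x0: "x i = 0" if "i \<noteq> 1" for i
  proof -
    have "of_int n * x i = 0"
      using ab that unfolding v by (auto simp: smul_def sroot_def fun_eq_iff)
    then show ?thesis using assms(2) by simp
  qed
  have y0: "y i = 0" for i
  proof -
    have "of_int n * y i = 0"
      using ab unfolding v by (auto simp: smul_def fun_eq_iff)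
    then show ?thesis using assms(2) by simp
  qed
  have z0: "z i = 0" if "i \<notin> {1..5}" for i
  proof -
    have "of_int n * z i = 0"
      using ab that unfolding v by (auto simp: smul_def sroot_def fun_eq_iff)
    then show ?thesis using assms(2) by simp
  qed
  obtain p q r where P:
    "\<And>i. x i - of_int (2 * p + 5 * q) * alpha i \<in> \<int>"
    "\<And>i. y i - of_int (4 * p + 5 * r) * alpha i \<in> \<int>"
    "\<And>i. z i - of_int q * delta6 i - of_int r * delta6' i \<in> \<int>"
    using assms(1) unfolding v L_iff root_lattice_iff by (auto simp: smul_def)
  have a9: "alpha 9 = 1/10" and a1: "alpha 1 = 9/10" by (simp_all add: alpha_def smul_def coords_of_def)
  have div: "10 dvd k" if "of_int k * (1/10) \<in> (\<int> :: rat set)" for k :: int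
  proof -
    from that obtain m where "(of_int k :: rat) = of_int (10 * m)" by (auto elim!: Ints_cases)
    then show ?thesis by (metis dvd_triv_left of_int_eq_iff)
  qed
  have "10 dvd 2 * p + 5 * q"
    using Ints_minus[OF P(1)[of 9]] x0[of 9] a9 div by simp
  then obtain m where m: "2 * p + 5 * q = 10 * m" by blast
  have "10 dvd 4 * p + 5 * r"
    using Ints_minus[OF P(2)[of 9]] y0[of 9] a9 div by simp
  then obtain m' where m': "4 * p + 5 * r = 10 * m'" by blast
  have "even q" "even r" using m m' by presburger+
  then obtain q' r' where qr: "q = 2 * q'" "r = 2 * r'" by (auto elim!: evenE)
  have "x 1 = (x 1 - of_int (2 * p + 5 * q) * alpha 1) + of_int (9 * m)"
    unfolding m a1 by simp
  then have x1: "x 1 \<in> \<int>" using P(1)[of 1] by (metis Ints_add Ints_of_int)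
  have z_int: "z i \<in> \<int>" if "i \<in> {1..5}" for i
  proof -
    have "2 * delta6 i \<in> \<int> \<and> 2 * delta6' i \<in> \<int>"
      using that by (auto simp: delta6_def delta6'_def smul_def coords_of_def nth_Cons split: nat.split)
    then have "of_int q' * (2 * delta6 i) + of_int r' * (2 * delta6' i) \<in> \<int>" by simp
    moreover have "z i = (z i - of_int q * delta6 i - of_int r * delta6' i)
        + (of_int q' * (2 * delta6 i) + of_int r' * (2 * delta6' i))"
      unfolding qr by (simp add: algebra_simps)
    ultimately show ?thesis using P(3)[of i] by (metis Ints_add)
  qed
  define u where "u = (\<lambda>i. if i \<in> {1..5::nat} then z (6 - i) else 0)"
  have "z (6 - i) \<in> \<int>" if "i \<in> {1..5}" for i by (rule z_int) (use that in auto)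
  then have "u \<in> root_lattice 5" unfolding root_lattice_iff u_def by auto
  moreover have "x \<in> root_lattice 1" using x0 x1 unfolding root_lattice_iff
    by (metis Ints_0 atLeastAtMost_singleton singletonI)
  moreover have "v = emb (u, x)"
  proof -
    have ex: "x = smul (x 1) (sroot 1)" using x0 by (auto simp: smul_def sroot_def fun_eq_iff)
    have ey: "y = 0" using y0 by (simp add: fun_eq_iff)
    have ez: "z i = (smul (u 1) (sroot 5) + smul (u 2) (sroot 4) + smul (u 3) (sroot 3)
       + smul (u 4) (sroot 2) + smul (u 5) (sroot 1)) i" for i
    proof (cases "i \<in> {1..5}")
      case True
      then have "i \<in> {1, 2, 3, 4, 5}" by auto
      then show ?thesis by (elim insertE) (simp_all add: smul_def sroot_def u_def)
    next
      case False
      then show ?thesis using z0[of i] by (auto simp: smul_def sroot_def)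
    qed
    show ?thesis unfolding v emb.simps prod.inject
      by (intro conjI ex ey) (rule ext, rule ez)
  qed
  ultimately show ?thesis unfolding A5_A1_def by blast
qed

lemma W_I:
  assumes "(x, y, z) \<in> L" "x 2 = 2 * x 1" "z 2 = 2 * z 1" "z 1 + z 3 = 2 * z 2" "z 2 + z 4 = 2 * z 3"
    "z 3 + z 5 + z 6 = 2 * z 4" "z 4 = 2 * z 5"
  shows "(x, y, z) \<in> W"
proof -
  have "bform (x, y, z) (emb (a, b)) = 0" for a b
  proof -
    have "bform (x, y, z) (emb (a, b)) = b 1 * (x 2 - 2 * x 1) + a 1 * (z 4 - 2 * z 5)
        + a 2 * (z 3 + z 5 + z 6 - 2 * z 4) + a 3 * (z 2 + z 4 - 2 * z 3)
        + a 4 * (z 1 + z 3 - 2 * z 2) + a 5 * (z 2 - 2 * z 1)"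
      unfolding emb.simps bform.simps form_A9_eq form_D6_eq
      by (simp add: smul_def sroot_def algebra_simps)
    also have "\<dots> = 0" using assms(2-7) by simp
    finally show ?thesis .
  qed
  then show ?thesis using assms(1) unfolding W_def orth_compl_def by auto
qed

lemma root_lattice_9I:
  assumes "\<And>i. i \<in> {1, 2, 3, 4, 5, 6, 7, 8, 9} \<Longrightarrow> x i \<in> \<int>" "\<And>i. i = 0 \<or> i > 9 \<Longrightarrow> x i = 0"
  shows "x \<in> root_lattice 9"
proof -
  have "x i \<in> \<int>" for i
  proof (cases "i \<in> {1..9}")
    case True
    then show ?thesis using assms(1) one_to_nine by blast
  next
    case False
    then have "i = 0 \<or> i > 9" by auto
    then show ?thesis using assms(2)[of i] by simp
  qed
  then show ?thesis using assms(2) unfolding root_lattice_iff by auto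
qed

lemma root_lattice_6I:
  assumes "\<And>i. i \<in> {1, 2, 3, 4, 5, 6} \<Longrightarrow> x i \<in> \<int>" "\<And>i. i = 0 \<or> i > 6 \<Longrightarrow> x i = 0"
  shows "x \<in> root_lattice 6"
proof -
  have "x i \<in> \<int>" for i
  proof (cases "i \<in> {1..6}")
    case True
    then show ?thesis using assms(1) one_to_six by blast
  next
    case False
    then have "i = 0 \<or> i > 6" by auto
    then show ?thesis using assms(2)[of i] by simp
  qed
  then show ?thesis using assms(2) unfolding root_lattice_iff by auto
qed

lemmas coords_simps = alpha_dual_eq alpha_def delta6_def delta6'_def smul_def coords_of_def sroot_def

lemma section_classI:
  assumes "(x, y, z) \<in> W" "bform (x, y, z) (x, y, z) = of_int (- 2 * k)"
  shows "section_class k (x, y, z) \<in> NS \<and>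
    ns_form (section_class k (x, y, z)) (section_class k (x, y, z)) = - 2 \<and>
    ns_form (section_class k (x, y, z)) fiber = 1"
proof -
  have "bform v (0, 0, 0) = 0" for v
    by (cases v) (simp add: form_A9_eq form_D6_eq)
  then have "bform (x, y, z) 0 = 0" by (simp add: zero_prod_def)
  then show ?thesis using assms by (simp add: section_class_def NS_def fiber_def)
qed

text \<open>The sections are classes \<open>S \<in> NS\<close> with \<open>S\<^sup>2 = -2\<close> and \<open>S \<cdot> F = 1\<close>.\<close>

lemma section_checks:
  fixes p q :: int
  assumes
    "\<And>i. i \<in> {1, 2, 3, 4, 5, 6, 7, 8, 9} \<Longrightarrow> x i - of_int (2 * p + 5 * q) * alpha i \<in> \<int>"
    "\<And>i. i = 0 \<or> i > 9 \<Longrightarrow> x i = 0"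
    "\<And>i. i \<in> {1, 2, 3, 4, 5, 6, 7, 8, 9} \<Longrightarrow> y i - of_int (4 * p) * alpha i \<in> \<int>"
    "\<And>i. i = 0 \<or> i > 9 \<Longrightarrow> y i = 0"
    "\<And>i. i \<in> {1, 2, 3, 4, 5, 6} \<Longrightarrow> z i - of_int q * delta6 i \<in> \<int>"
    "\<And>i. i = 0 \<or> i > 6 \<Longrightarrow> z i = 0"
    "x 2 = 2 * x 1" "z 2 = 2 * z 1" "z 1 + z 3 = 2 * z 2" "z 2 + z 4 = 2 * z 3"
    "z 3 + z 5 + z 6 = 2 * z 4" "z 4 = 2 * z 5"
    "form_A 9 x x + form_A 9 y y + form_D6 z z = of_int (- 2 * k)"
  shows "section_class k (x, y, z) \<in> NS \<and>
    ns_form (section_class k (x, y, z)) (section_class k (x, y, z)) = - 2 \<and>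
    ns_form (section_class k (x, y, z)) fiber = 1"
proof (rule section_classI)
  have out: "alpha i = 0" if "i = 0 \<or> i > 9" for i
    using that by (auto simp: alpha_def smul_def coords_of_def)
  have out': "delta6 i = 0" if "i = 0 \<or> i > 6" for i
    using that by (auto simp: delta6_def smul_def coords_of_def)
  have "x - smul (of_int (2 * p + 5 * q)) alpha \<in> root_lattice 9"
    by (rule root_lattice_9I) (use assms(1,2) out in \<open>simp_all add: smul_def\<close>)
  moreover have "y - smul (of_int (4 * p + 5 * 0)) alpha \<in> root_lattice 9"
    by (rule root_lattice_9I) (use assms(3,4) out in \<open>simp_all add: smul_def\<close>)
  moreover have "z - smul (of_int q) delta6 - smul (of_int 0) delta6' \<in> root_lattice 6"
    by (rule root_lattice_6I) (use assms(5,6) out' in \<open>simp_all add: smul_def\<close>)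
  ultimately have "(x, y, z) \<in> L" unfolding L_iff by blast
  then show "(x, y, z) \<in> W" by (rule W_I) (use assms in simp_all)
  show "bform (x, y, z) (x, y, z) = of_int (- 2 * k)" using assms(13) by simp
qed

lemma sections:
  "\<forall>S\<in>{V1, V2, V3, V4, V5, V6, V7, V8, V9, V11, V12}.
     S \<in> NS \<and> ns_form S S = - 2 \<and> ns_form S fiber = 1"
proof -
  have "V1 \<in> NS \<and> ns_form V1 V1 = - 2 \<and> ns_form V1 fiber = 1"
    unfolding V1_def
    by (rule section_checks[of _ 3 1]; (elim insertE emptyE)?)
      (auto simp: form_A9_eq form_D6_eq coords_simps)
  moreover
  have "V2 \<in> NS \<and> ns_form V2 V2 = - 2 \<and> ns_form V2 fiber = 1"
    unfolding V2_def
    by (rule section_checks[of _ 1 0]; (elim insertE emptyE)?)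
      (auto simp: form_A9_eq form_D6_eq coords_simps)
  moreover
  have "V3 \<in> NS \<and> ns_form V3 V3 = - 2 \<and> ns_form V3 fiber = 1"
    unfolding V3_def
    by (rule section_checks[of _ 4 1]; (elim insertE emptyE)?)
      (auto simp: form_A9_eq form_D6_eq coords_simps)
  moreover
  have "V4 \<in> NS \<and> ns_form V4 V4 = - 2 \<and> ns_form V4 fiber = 1"
    unfolding V4_def
    by (rule section_checks[of _ 2 0]; (elim insertE emptyE)?)
      (auto simp: form_A9_eq form_D6_eq coords_simps)
  moreover
  have "V5 \<in> NS \<and> ns_form V5 V5 = - 2 \<and> ns_form V5 fiber = 1"
    unfolding V5_def
    by (rule section_checks[of _ 0 1]; (elim insertE emptyE)?)
      (auto simp: form_A9_eq form_D6_eq coords_simps)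
  moreover
  have "V6 \<in> NS \<and> ns_form V6 V6 = - 2 \<and> ns_form V6 fiber = 1"
    unfolding V6_def
    by (rule section_checks[of _ 3 0]; (elim insertE emptyE)?)
      (auto simp: form_A9_eq form_D6_eq coords_simps)
  moreover
  have "V7 \<in> NS \<and> ns_form V7 V7 = - 2 \<and> ns_form V7 fiber = 1"
    unfolding V7_def
    by (rule section_checks[of _ 1 1]; (elim insertE emptyE)?)
      (auto simp: form_A9_eq form_D6_eq coords_simps)
  moreover
  have "V8 \<in> NS \<and> ns_form V8 V8 = - 2 \<and> ns_form V8 fiber = 1"
    unfolding V8_def
    by (rule section_checks[of _ 4 0]; (elim insertE emptyE)?)
      (auto simp: form_A9_eq form_D6_eq coords_simps)
  moreover
  have "V9 \<in> NS \<and> ns_form V9 V9 = - 2 \<and> ns_form V9 fiber = 1"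
    unfolding V9_def
    by (rule section_checks[of _ 2 1]; (elim insertE emptyE)?)
      (auto simp: form_A9_eq form_D6_eq coords_simps)
  moreover
  have "V11 \<in> NS \<and> ns_form V11 V11 = - 2 \<and> ns_form V11 fiber = 1"
    unfolding V11_def
    by (rule section_checks[of _ 0 0]; (elim insertE emptyE)?)
      (auto simp: form_A9_eq form_D6_eq coords_simps)
  moreover
  have "V12 \<in> NS \<and> ns_form V12 V12 = - 2 \<and> ns_form V12 fiber = 1"
    unfolding V12_def
    by (rule section_checks[of _ 0 0]; (elim insertE emptyE)?)
      (auto simp: form_A9_eq form_D6_eq coords_simps)
  ultimately show ?thesis by blast
qed

end

theory Submission
  imports Defs
begin

text \<open>
  Let \<open>K = \<langle>a\<^sub>3, \<dots>, a\<^sub>9\<rangle> \<oplus> A\<^sub>9\<close>.  A vector \<open>(x, y, z)\<close> of \<open>W\<close> satisfies \<open>x\<^sub>2 = 2 x\<^sub>1\<close> and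
  \<open>z = t \<delta>\<^sub>6\<close>, and \<open>(m, t) = (10 x\<^sub>1, 2 z\<^sub>1)\<close> identifies \<open>W / K\<close> with the pairs of integers of equal
  parity and \<open>N / K\<close> with \<open>10\<int> \<oplus> 2\<int>\<close>.  Minimal norms in the cosets of \<open>A\<^sub>9\<close> in its dual show that
  all roots of \<open>W\<close> lie in \<open>K\<close>, which is generated by roots.  The height of the class \<open>(m, t)\<close> is
  \<open>(m\<^sup>2 + 60 t\<^sup>2) / 40\<close>.  Two classes generate if and only if their determinant is \<open>\<plusminus>2\<close>, and since
  \<open>61 x\<^sup>2 + 4 x y + 4 y\<^sup>2 = (x + 2 y)\<^sup>2 + 60 x\<^sup>2\<close>, every such pair has a height matrix equivalent to \<open>Q\<close>.
\<close>

section \<open>Coefficients of the glue vectors and norm bounds on the dual of A_9\<close>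

lemma alpha_coeffs [simp]:
  "alpha 1 = 9/10" "alpha 2 = 8/10" "alpha 3 = 7/10" "alpha 4 = 6/10" "alpha 5 = 5/10"
  "alpha 6 = 4/10" "alpha 7 = 3/10" "alpha 8 = 2/10" "alpha 9 = 1/10"
  by (simp_all add: alpha_def smul_def coords_of_def)

lemma delta6_coeffs [simp]:
  "delta6 1 = 1/2" "delta6 2 = 1" "delta6 3 = 3/2" "delta6 4 = 2" "delta6 5 = 1" "delta6 6 = 3/2"
  by (simp_all add: delta6_def smul_def coords_of_def)

lemma delta6'_coeffs [simp]:
  "delta6' 1 = 1/2" "delta6' 2 = 1" "delta6' 3 = 3/2" "delta6' 4 = 2" "delta6' 5 = 3/2" "delta6' 6 = 1"
  by (simp_all add: delta6'_def smul_def coords_of_def)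

text \<open>The simplifier turns the index \<open>1\<close> into \<open>Suc 0\<close>, so the values
  at the first root are stored in that form as well.\<close>

lemmas [simp] = alpha_coeffs(1)[unfolded One_nat_def] delta6_coeffs(1)[unfolded One_nat_def]
  delta6'_coeffs(1)[unfolded One_nat_def]

lemma alpha_outside: "i \<notin> {1..9} \<Longrightarrow> alpha i = 0"
  by (auto simp: alpha_def smul_def coords_of_def)

lemma delta6_outside: "i \<notin> {1..6} \<Longrightarrow> delta6 i = 0" "i \<notin> {1..6} \<Longrightarrow> delta6' i = 0"
  by (auto simp: delta6_def delta6'_def smul_def coords_of_def)

lemma mult_alpha_Ints: "of_int (10 * k) * alpha i \<in> \<int>"
proof (cases "i \<in> {1..9}")
  case True
  then have "i \<in> {1, 2, 3, 4, 5, 6, 7, 8, 9}" unfolding one_to_nine .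
  then show ?thesis by (elim insertE) (simp_all del: One_nat_def)
qed (simp add: alpha_outside)

lemma mult_delta6_Ints: "of_int (2 * k) * delta6 i \<in> \<int>"
proof (cases "i \<in> {1..6}")
  case True
  then have "i \<in> {1, 2, 3, 4, 5, 6}" unfolding one_to_six .
  then show ?thesis by (elim insertE) (simp_all del: One_nat_def)
qed (simp add: delta6_outside)

lemma root_lattice_alpha_shift:
  assumes "x - smul (of_int i) alpha \<in> root_lattice 9" "10 dvd i - j"
  shows "x - smul (of_int j) alpha \<in> root_lattice 9"
proof -
  obtain k where k: "i = j + 10 * k" using assms(2) by (metis diff_eq_eq add.commute dvdE)
  have e: "(x - smul (of_int j) alpha) l
      = (x - smul (of_int i) alpha) l + of_int (10 * k) * alpha l" for l
    unfolding k by (simp add: smul_def algebra_simps)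
  show ?thesis using assms(1) mult_alpha_Ints[of k] alpha_outside unfolding root_lattice_iff e
    by auto
qed

text \<open>In the model \<open>A\<^sub>9 \<subseteq> \<int>\<^sup>1\<^sup>0\<close> the class \<open>i\<close> consists of the vectors
  \<open>e - (i/10, \<dots>, i/10)\<close> with \<open>e\<close> integral of coordinate sum \<open>i\<close>; the bound is
  \<open>\<Sum> e\<^sub>k\<^sup>2 \<ge> \<Sum> e\<^sub>k\<close>.\<close>

lemma A9_dual_norm_ge:
  assumes "x - smul (of_int i) alpha \<in> root_lattice 9"
  shows "- form_A 9 x x \<ge> of_int (i * (10 - i)) / 10"
proof -
  have "\<exists>n. x k = of_int n + of_int i * alpha k" for k
  proof -
    have "x k - of_int i * alpha k \<in> \<int>" using assms unfolding root_lattice_iff smul_def by simp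
    then show ?thesis by (metis Ints_cases diff_eq_eq)
  qed
  then obtain n where n: "\<And>k. x k = of_int (n k) + of_int i * alpha k" by metis
  have sq: "(0::rat) \<le> of_int (a * a - a)" for a :: int
  proof -
    have "0 \<le> a * (a - 1)" by (cases "a \<le> 0") (auto intro: mult_nonpos_nonpos)
    then show ?thesis by (simp only: right_diff_distrib mult_1_right of_int_0_le_iff)
  qed
  \<comment> \<open>The integers squared here are the e_k of the model: successive differences of
    the \<open>n k\<close>, closed off by \<open>n 1 + i\<close> and \<open>- n 9\<close>, so that
    they sum to \<open>i\<close>.\<close>
  have "- form_A 9 x x - of_int (i * (10 - i)) / 10 =
      of_int ((n 1 + i) * (n 1 + i) - (n 1 + i)) + of_int ((n 2 - n 1) * (n 2 - n 1) - (n 2 - n 1))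
    + of_int ((n 3 - n 2) * (n 3 - n 2) - (n 3 - n 2)) + of_int ((n 4 - n 3) * (n 4 - n 3) - (n 4 - n 3))
    + of_int ((n 5 - n 4) * (n 5 - n 4) - (n 5 - n 4)) + of_int ((n 6 - n 5) * (n 6 - n 5) - (n 6 - n 5))
    + of_int ((n 7 - n 6) * (n 7 - n 6) - (n 7 - n 6)) + of_int ((n 8 - n 7) * (n 8 - n 7) - (n 8 - n 7))
    + of_int ((n 9 - n 8) * (n 9 - n 8) - (n 9 - n 8)) + of_int ((- n 9) * (- n 9) - (- n 9))"
    unfolding form_A9_eq n alpha_coeffs by (simp add: field_simps)
  also have "\<dots> \<ge> 0" by (intro add_nonneg_nonneg sq)
  finally show ?thesis by simp
qed

lemma A9_dual_norm_ge_shift: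
  assumes "x - smul (of_int i) alpha \<in> root_lattice 9" "i = j + 10 * k"
  shows "- form_A 9 x x \<ge> of_int (j * (10 - j)) / 10"
  by (rule A9_dual_norm_ge[OF root_lattice_alpha_shift[OF assms(1)]]) (simp add: assms(2))

text \<open>In the ten coordinates of the model the first two contribute \<open>(x 1)^2\<close>
  each, and the other eight sum to \<open>- 2 * x 1\<close>, so by Cauchy-Schwarz their squares add
  up to at least \<open>(x 1)^2 / 2\<close>. The squares in the proof are the deviations from the
  mean \<open>- x 1 / 4\<close>.\<close>

lemma A9_norm_ge_first:
  assumes "x 2 = 2 * x 1"
  shows "- form_A 9 x x \<ge> 5/2 * (x 1)^2"
proof -
  have "- form_A 9 x x - 5/2 * (x 1)^2 = (x 3 - x 2 + x 1 / 4)^2 + (x 4 - x 3 + x 1 / 4)^2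
    + (x 5 - x 4 + x 1 / 4)^2 + (x 6 - x 5 + x 1 / 4)^2 + (x 7 - x 6 + x 1 / 4)^2
    + (x 8 - x 7 + x 1 / 4)^2 + (x 9 - x 8 + x 1 / 4)^2 + (- x 9 + x 1 / 4)^2"
    unfolding form_A9_eq assms by (simp add: field_simps power2_eq_square)
  also have "\<dots> \<ge> 0" by simp
  finally show ?thesis by simp
qed

section \<open>Coordinates on \<open>W\<close> and criteria for lying in \<open>N\<close> and
  \<open>K\<close>\<close>

text \<open>Orthogonality to d_1, ..., d_5 confines \<open>z\<close> to the line of
  \<open>delta6\<close>. This makes the coefficient \<open>r\<close> of the third glue vector even,
  so \<open>5 * r\<close> vanishes modulo 10 and the two half-spin coefficients merge into the
  single integer \<open>t\<close>.\<close>

lemma W_D: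
  assumes "(x, y, z) \<in> W"
  obtains p t :: int where
    "x - smul (of_int (2 * p + 5 * t)) alpha \<in> root_lattice 9"
    "y - smul (of_int (4 * p)) alpha \<in> root_lattice 9"
    "z = smul (of_int t) delta6" "x 2 = 2 * x 1"
proof -
  have "(x, y, z) \<in> L" and orth: "\<And>u. u \<in> A5_A1 \<Longrightarrow> bform (x, y, z) (emb u) = 0"
    using assms unfolding W_def orth_compl_def by auto
  then obtain p q r :: int where
    px: "x - smul (of_int (2 * p + 5 * q)) alpha \<in> root_lattice 9" and
    py: "y - smul (of_int (4 * p + 5 * r)) alpha \<in> root_lattice 9" and
    pz: "z - smul (of_int q) delta6 - smul (of_int r) delta6' \<in> root_lattice 6"
    unfolding L_iff by blast
  have o: "bform (x, y, z) (emb (sroot i, 0)) = 0" if "i \<in> {1..5}" for i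
    by (rule orth) (use that in \<open>auto simp: A5_A1_def root_lattice_iff sroot_def\<close>)
  have "bform (x, y, z) (emb (0, sroot 1)) = 0"
    by (rule orth) (auto simp: A5_A1_def root_lattice_iff sroot_def)
  then have x2: "x 2 = 2 * x 1"
    by (simp add: form_A9_eq form_D6_eq smul_def sroot_def)
  have z: "z 2 = 2 * z 1" "z 3 = 3 * z 1" "z 4 = 4 * z 1" "z 5 = 2 * z 1" "z 6 = 3 * z 1"
    using o[of 1] o[of 2] o[of 3] o[of 4] o[of 5]
    by (simp_all add: form_A9_eq form_D6_eq smul_def sroot_def)
  have z0: "z i = 0" if "i \<notin> {1..6}" for i
    using pz that delta6_outside[OF that] unfolding root_lattice_iff by (auto simp: smul_def)
  have int: "z i - of_int q * delta6 i - of_int r * delta6' i \<in> \<int>" for i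
    using pz unfolding root_lattice_iff by (auto simp: smul_def)
  obtain k where k: "z 1 - of_int q / 2 - of_int r / 2 = of_int k"
    using int[of 1] by (auto elim!: Ints_cases)
  define t where "t = 2 * k + q + r"
  have z1: "z 1 = of_int t / 2" using k unfolding t_def by (simp add: field_simps)
  \<comment> \<open>The coefficient at d_5 is integral in \<open>delta6\<close> but half-integral in
    \<open>delta6'\<close>; as \<open>z 5 = of_int t\<close> is integral, it detects the parity of
    \<open>r\<close>.\<close>
  obtain k' where k': "z 5 - of_int q - of_int r * (3/2) = of_int k'"
    using int[of 5] by (auto elim!: Ints_cases)
  have "(of_int (2 * t - 2 * q - 3 * r) :: rat) = of_int (2 * k')"
    using k' unfolding z z1 by simp
  then have "2 * t - 2 * q - 3 * r = 2 * k'" by (simp only: of_int_eq_iff)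
  then have "r = 2 * (t - q - r - k')" by simp
  then obtain s where s: "r = 2 * s" by blast
  have zt: "z = smul (of_int t) delta6"
  proof
    fix i
    show "z i = smul (of_int t) delta6 i"
    proof (cases "i \<in> {1..6}")
      case True
      then have "i \<in> {1, 2, 3, 4, 5, 6}" unfolding one_to_six .
      then show ?thesis by (elim insertE) (simp_all add: smul_def z z1 del: One_nat_def)
    qed (simp add: z0 delta6_outside smul_def)
  qed
  show ?thesis
  proof (rule that[OF root_lattice_alpha_shift[OF px] root_lattice_alpha_shift[OF py] zt x2])
    show "10 dvd 2 * p + 5 * q - (2 * p + 5 * t)" "10 dvd 4 * p + 5 * r - 4 * p"
      by (simp_all add: t_def s)
  qed
qed

definition cx :: "vec3 \<Rightarrow> rat" where "cx v = 10 * fst v 1"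
definition cz :: "vec3 \<Rightarrow> rat" where "cz v = 2 * snd (snd v) 1"

lemma cx_cz_linear:
  "cx (v + w) = cx v + cx w" "cx (v - w) = cx v - cx w" "cx (qscale c v) = c * cx v"
  "cz (v + w) = cz v + cz w" "cz (v - w) = cz v - cz w" "cz (qscale c v) = c * cz v"
  by (cases v; cases w; simp add: cx_def cz_def smul_def algebra_simps)+

text \<open>Modulo 10 the first coordinate is \<open>9 * (2 * p + 5 * t)\<close>, which has the
  parity of \<open>t\<close>.\<close>

lemma W_coords:
  assumes "v \<in> W"
  obtains m t :: int where "cx v = of_int m" "cz v = of_int t" "even (m - t)"
proof -
  obtain x y z where v: "v = (x, y, z)" by (cases v)
  obtain p t where pt: "x - smul (of_int (2 * p + 5 * t)) alpha \<in> root_lattice 9"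
    "z = smul (of_int t) delta6" using W_D assms v by blast
  then have "x 1 - of_int (2 * p + 5 * t) * (9/10) \<in> \<int>"
    unfolding root_lattice_iff by (metis alpha_coeffs(1) minus_apply smul_def)
  then obtain k where k: "x 1 - of_int (2 * p + 5 * t) * (9/10) = of_int k"
    by (auto elim: Ints_cases)
  have "cx v = of_int (10 * k + 9 * (2 * p + 5 * t))"
    using k unfolding v cx_def by (simp add: field_simps)
  moreover have "cz v = of_int t" unfolding v cz_def pt by (simp add: smul_def del: One_nat_def)
  ultimately show ?thesis by (rule that) simp
qed

definition K :: "vec3 set" where
  "K = {(x, y, z). x \<in> root_lattice 9 \<and> y \<in> root_lattice 9 \<and> z = 0 \<and> x 1 = 0 \<and> x 2 = 0}"

lemma L_root_subset_L: "L_root \<subseteq> L"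
  unfolding L_def by (auto intro: group_closure.base)

lemma N_eq: "N = W \<inter> L_root"
  unfolding N_def W_def orth_compl_def using L_root_subset_L by auto

lemma K_subset_N: "K \<subseteq> N"
proof
  fix v assume "v \<in> K"
  then obtain x y where v: "v = (x, y, 0)" "x \<in> root_lattice 9" "y \<in> root_lattice 9" "x 1 = 0" "x 2 = 0"
    unfolding K_def by auto
  then have L: "v \<in> L_root" unfolding L_root_def by (auto simp: root_lattice_iff)
  then have "v \<in> W" using L_root_subset_L v by (auto intro!: W_I)
  with L show "v \<in> N" unfolding N_eq by blast
qed

lemma N_subset_W: "N \<subseteq> W" unfolding N_eq by blast

lemma K_subset_W: "K \<subseteq> W" using K_subset_N N_subset_W by blast

text \<open>An even second coordinate puts \<open>z\<close> into D_6 and makes \<open>5 * t\<close>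
  a multiple of 10. Since 9 is a unit modulo 10, a first coordinate divisible by 10 then makes both
  glue classes \<open>2 * p + 5 * t\<close> and \<open>4 * p\<close> trivial.\<close>

lemma mem_N_iff:
  assumes "v \<in> W"
  shows "v \<in> N \<longleftrightarrow> (\<exists>a b::int. cx v = of_int (10 * a) \<and> cz v = of_int (2 * b))"
proof
  obtain x y z where v: "v = (x, y, z)" by (cases v)
  {
    assume "v \<in> N"
    then have "x \<in> root_lattice 9" "z \<in> root_lattice 6" unfolding N_eq L_root_def v by auto
    then have "x 1 \<in> \<int>" "z 1 \<in> \<int>" unfolding root_lattice_iff by blast+
    then obtain a b where "x 1 = of_int a" "z 1 = of_int b" by (auto elim!: Ints_cases)
    then show "\<exists>a b::int. cx v = of_int (10 * a) \<and> cz v = of_int (2 * b)"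
      unfolding cx_def cz_def v by auto
  }
  assume "\<exists>a b::int. cx v = of_int (10 * a) \<and> cz v = of_int (2 * b)"
  then obtain a b where a: "x 1 = of_int a" and b: "z 1 = of_int b" unfolding cx_def cz_def v by auto
  obtain p t where pt: "x - smul (of_int (2 * p + 5 * t)) alpha \<in> root_lattice 9"
    "y - smul (of_int (4 * p)) alpha \<in> root_lattice 9"
    "z = smul (of_int t) delta6" using W_D assms v by blast
  have "(of_int t :: rat) = of_int (2 * b)" using b unfolding pt(3) by (simp add: smul_def del: One_nat_def)
  then have t: "t = 2 * b" by (simp only: of_int_eq_iff)
  have "x 1 - of_int (2 * p + 5 * t) * (9/10) \<in> \<int>"
    using pt(1) unfolding root_lattice_iff by (metis alpha_coeffs(1) minus_apply smul_def)
  then obtain k where "x 1 - of_int (2 * p + 5 * t) * (9/10) = of_int k"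
    by (auto elim: Ints_cases)
  then have "(of_int (10 * a) :: rat) = of_int (9 * (2 * p + 5 * t) + 10 * k)"
    unfolding a by (simp add: field_simps)
  then have "10 * a = 9 * (2 * p + 5 * t) + 10 * k" by (simp only: of_int_eq_iff)
  \<comment> \<open>The previous equation is solved for \<open>2 * p + 5 * t\<close> by writing 9 as
    10 - 1; then \<open>4 * p\<close> is twice that number minus \<open>10 * t\<close>.\<close>
  then have "2 * p + 5 * t = 10 * (2 * p + 5 * t - a + k)" "4 * p = 10 * (2 * (2 * p + 5 * t - a + k) - 2 * b)"
    using t by simp_all
  then have d: "10 dvd (2 * p + 5 * t) - 0" "10 dvd 4 * p - 0" by (metis diff_zero dvd_triv_left)+
  have "x \<in> root_lattice 9" "y \<in> root_lattice 9"
    using root_lattice_alpha_shift[OF pt(1) d(1)] root_lattice_alpha_shift[OF pt(2) d(2)]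
    by (simp_all add: smul_def flip: zero_fun_def)
  moreover have "z \<in> root_lattice 6"
    unfolding root_lattice_iff pt(3) smul_def t using mult_delta6_Ints[of b] delta6_outside(1) by simp
  ultimately show "v \<in> N" using assms unfolding N_eq L_root_def v by simp
qed

text \<open>Zero coordinates are in particular multiples of 10 and 2, so \<open>mem_N_iff\<close>
  supplies integrality; what remains is that \<open>z\<close> is a multiple of \<open>delta6\<close>
  and \<open>x 2 = 2 * x 1\<close>. Hence \<open>cx\<close> and \<open>cz\<close> together are
  injective on \<open>W / K\<close>.\<close>

lemma mem_K_iff:
  assumes "v \<in> W"
  shows "v \<in> K \<longleftrightarrow> cx v = 0 \<and> cz v = 0"
proof
  obtain x y z where v: "v = (x, y, z)" by (cases v)
  show "v \<in> K \<Longrightarrow> cx v = 0 \<and> cz v = 0" unfolding K_def v cx_def cz_def by simp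
  assume 0: "cx v = 0 \<and> cz v = 0"
  then have "v \<in> N" unfolding mem_N_iff[OF assms] by (metis mult_zero_right of_int_0)
  then have "x \<in> root_lattice 9" "y \<in> root_lattice 9" unfolding N_eq L_root_def v by auto
  moreover obtain t where t: "z = smul (of_int t) delta6" "x 2 = 2 * x 1" using W_D assms v by blast
  moreover have "z = 0"
    using 0 unfolding v cz_def t by (simp add: smul_def fun_eq_iff del: One_nat_def)
  ultimately show "v \<in> K" using 0 unfolding K_def v cx_def by simp
qed

section \<open>The root sublattices of \<open>W\<close> and \<open>N\<close>\<close>

text \<open>The norm 2 splits into the two A_9 parts \<open>X\<close>, \<open>Y\<close> and
  \<open>3/2 * t^2\<close>. If t is 1 or -1, the first glue class is odd and costs at least 9/10,
  too much next to 3/2. With t = 0 the glue classes must be trivial, and then a nonzero integral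
  \<open>x 1\<close> would cost at least 5/2.\<close>

lemma root_of_W_in_K:
  assumes "v \<in> W" "bform v v = - 2"
  shows "v \<in> K"
proof -
  obtain x y z where v: "v = (x, y, z)" by (cases v)
  obtain p t where px: "x - smul (of_int (2 * p + 5 * t)) alpha \<in> root_lattice 9" and
    py: "y - smul (of_int (4 * p)) alpha \<in> root_lattice 9" and
    z: "z = smul (of_int t) delta6" and x2: "x 2 = 2 * x 1" using W_D assms v by blast
  define X where "X = - form_A 9 x x"
  define Y where "Y = - form_A 9 y y"
  have "form_D6 z z = - 3/2 * of_int (t * t)"
    unfolding z form_D6_eq smul_def delta6_coeffs by (simp add: field_simps)
  then have norm: "X + Y + 3/2 * of_int (t * t) = 2" using assms(2) unfolding v X_def Y_def by simp
  note X = A9_dual_norm_ge_shift[OF px, folded X_def] and Y = A9_dual_norm_ge_shift[OF py, folded Y_def]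
  let ?i = "2 * p + 5 * t"
  have j: "0 \<le> k mod 10" "k mod 10 < 10" "k = k mod 10 + 10 * (k div 10)" for k :: int by simp_all
  have nonneg: "(0::rat) \<le> of_int ((k mod 10) * (10 - k mod 10)) / 10" for k :: int
    using j[of k] by (simp del: of_int_mult)
  have X0: "X \<ge> 0" and Y0: "Y \<ge> 0" using X[OF j(3)] Y[OF j(3)] nonneg order_trans by blast+
  have t0: "t = 0"
  proof (rule ccontr)
    assume "t \<noteq> 0"
    have "(of_int (3 * (t * t)) :: rat) \<le> of_int 4" using norm X0 Y0 by simp
    then have tt: "3 * (t * t) \<le> 4" by (simp only: of_int_le_iff)
    have "\<bar>t\<bar> * \<bar>t\<bar> \<le> 1" using tt by simp
    moreover have "\<bar>t\<bar> \<ge> 2 \<Longrightarrow> \<bar>t\<bar> * \<bar>t\<bar> \<ge> 2 * 2" by (intro mult_mono) auto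
    ultimately have t1: "t = 1 \<or> t = -1" using \<open>t \<noteq> 0\<close> by fastforce
    then have "odd ?i" by auto
    have "?i mod 10 \<noteq> 0"
    proof
      assume "?i mod 10 = 0"
      then have "?i = 2 * (5 * (?i div 10))" using j(3)[of ?i] by linarith
      then show False using \<open>odd ?i\<close> by (metis dvd_triv_left)
    qed
    \<comment> \<open>For a residue j from 1 to 9, the bound j(10 - j) \<ge> 9 is the expanded form
      of (j - 1)(9 - j) \<ge> 0.\<close>
    then have "0 \<le> (?i mod 10 - 1) * (9 - ?i mod 10)" using j[of ?i] by (intro mult_nonneg_nonneg) linarith+
    then have "9 \<le> (?i mod 10) * (10 - ?i mod 10)" by (simp add: algebra_simps)
    then have "(of_int 9 :: rat) \<le> of_int ((?i mod 10) * (10 - ?i mod 10))" by (simp only: of_int_le_iff)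
    then have "X \<ge> 9/10" using X[OF j(3)] by simp
    then show False using norm t1 Y0 by auto
  qed
  define s where "s = p div 5"
  have "p = 5 * s + p mod 5" "0 \<le> p mod 5" "p mod 5 < 5" unfolding s_def by simp_all
  then consider "p = 5 * s" | "p = 5 * s + 1" | "p = 5 * s + 2" | "p = 5 * s + 3" | "p = 5 * s + 4"
    by linarith
  \<comment> \<open>In every nonzero class of \<open>p\<close> modulo 5 the minimal norms for
    \<open>2 * p\<close> and \<open>4 * p\<close> are 8/5 and 12/5 in some order, with sum 4 >
    2.\<close>
  then have "p = 5 * s"
  proof cases
    case 2
    then show ?thesis using X[of 2 s] Y[of 4 "2 * s"] norm t0 by simp
  next
    case 3
    then show ?thesis using X[of 4 s] Y[of 8 "2 * s"] norm t0 by simp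
  next
    case 4
    then show ?thesis using X[of 6 s] Y[of 2 "2 * s + 1"] norm t0 by simp
  next
    case 5
    then show ?thesis using X[of 8 s] Y[of 6 "2 * s + 1"] norm t0 by simp
  qed
  then have d: "10 dvd (2 * p + 5 * t) - 0" unfolding t0 by simp
  then have "x \<in> root_lattice 9"
    using root_lattice_alpha_shift[OF px d] by (simp add: smul_def flip: zero_fun_def)
  then obtain k where k: "x 1 = of_int k" unfolding root_lattice_iff by (metis Ints_cases)
  have "5/2 * (x 1)^2 \<le> 2" using A9_norm_ge_first[OF x2] norm Y0 unfolding X_def t0 by simp
  then have "(of_int (5 * (k * k)) :: rat) \<le> of_int 4" unfolding k by (simp add: power2_eq_square)
  then have kk: "5 * (k * k) \<le> 4" by (simp only: of_int_le_iff)
  have "\<not> 0 < k * k" using kk by simp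
  then have "k = 0" by (simp add: zero_less_mult_iff) 
  then have "cx v = 0 \<and> cz v = 0" using k unfolding v cx_def cz_def z t0 by (simp add: smul_def)
  then show ?thesis using mem_K_iff assms by simp
qed

lemma group_closure_image_subset:
  assumes "x \<in> group_closure S" "\<And>s. s \<in> S \<Longrightarrow> f s \<in> group_closure T"
    "f 0 = 0" "\<And>a b. f (a - b) = f a - f b"
  shows "f x \<in> group_closure T"
  using assms(1)
proof (induction rule: group_closure.induct)
  case (base s)
  then show ?case using assms(2,3) by auto
next
  case (diff s t)
  show ?case unfolding assms(4) by (rule group_closure.diff[OF diff.IH])
qed

lemma root_lattice_diff:
  "x \<in> root_lattice n \<Longrightarrow> y \<in> root_lattice n \<Longrightarrow> x - y \<in> root_lattice n"
  unfolding root_lattice_def by (rule group_closure.diff)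

lemma K_diff: "v \<in> K \<Longrightarrow> w \<in> K \<Longrightarrow> v - w \<in> K"
  unfolding K_def by (auto intro: root_lattice_diff)

lemma K_zero: "0 \<in> K"
  unfolding K_def by (simp add: zero_prod_def root_lattice_iff)

text \<open>Any such \<open>M\<close> contains the simple roots a_3, ..., a_9 and those of the
  second A_9, which generate \<open>K\<close>, and has no roots outside \<open>K\<close>. An
  intermediate \<open>M\<close> treats \<open>W\<close> and \<open>N\<close> at once.\<close>

lemma root_sublattice_eq_K:
  assumes "K \<subseteq> M" "M \<subseteq> W"
  shows "root_sublattice M = K"
proof
  let ?R = "{v \<in> M. bform v v = - 2}"
  show "root_sublattice M \<subseteq> K"
  proof
    fix v assume "v \<in> root_sublattice M"
    then show "v \<in> K" unfolding root_sublattice_def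
    proof (induction rule: group_closure.induct)
      case (base s)
      then show ?case using assms(2) root_of_W_in_K K_zero by blast
    next
      case (diff s t)
      then show ?case by (blast intro: K_diff)
    qed
  qed
  have sroot_mem: "sroot k \<in> root_lattice n" if "k \<in> {1..n}" for k n
    using that unfolding root_lattice_def by (intro group_closure.base) blast
  have root: "form_A 9 (sroot k) (sroot k) = - 2" if "k \<in> {1..9}" for k
  proof -
    have "k \<in> {1, 2, 3, 4, 5, 6, 7, 8, 9}" using that unfolding one_to_nine .
    then show ?thesis unfolding form_A9_eq by (elim insertE) (simp_all add: sroot_def)
  qed
  \<comment> \<open>Shifting indices by two carries A_7 onto the span of a_3, ..., a_9;
    \<open>g\<close> is the inclusion of the second A_9.\<close>
  define f where "f = (\<lambda>a::coords. ((\<lambda>i. if i < 3 then 0 else a (i - 2)), 0 :: coords, 0 :: coords))"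
  define g where "g = (\<lambda>a::coords. (0 :: coords, a, 0 :: coords))"
  have form0: "form_A 9 0 0 = 0" "form_D6 0 0 = 0" by (simp_all add: form_A9_eq form_D6_eq)
  have f: "f a \<in> group_closure ?R" if "a \<in> root_lattice 7" for a
  proof (rule group_closure_image_subset[OF that[unfolded root_lattice_def]])
    fix s assume "s \<in> sroot ` {1..7::nat}"
    then obtain k where k: "s = sroot k" "k \<in> {1..7}" by blast
    have fs: "f s = (sroot (k + 2), 0, 0)" using k(2) unfolding k(1) f_def by (auto simp: sroot_def fun_eq_iff)
    have "f s \<in> K" using k(2) sroot_mem[of "k + 2" 9] unfolding fs K_def
      by (auto simp: root_lattice_iff sroot_def)
    moreover have "bform (f s) (f s) = - 2" using k(2) root[of "k + 2"] form0 unfolding fs by simp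
    ultimately show "f s \<in> group_closure ?R" using assms(1) by (intro group_closure.base) blast
  qed (simp_all add: f_def zero_prod_def fun_eq_iff)
  have g: "g a \<in> group_closure ?R" if "a \<in> root_lattice 9" for a
  proof (rule group_closure_image_subset[OF that[unfolded root_lattice_def]])
    fix s assume "s \<in> sroot ` {1..9::nat}"
    then obtain k where k: "s = sroot k" "k \<in> {1..9}" by blast
    have "g s \<in> K" using k(2) sroot_mem[of k 9] unfolding k(1) g_def K_def
      by (auto simp: root_lattice_iff)
    moreover have "bform (g s) (g s) = - 2" using k(2) root[of k] form0 unfolding k(1) g_def by simp
    ultimately show "g s \<in> group_closure ?R" using assms(1) by (intro group_closure.base) blast
  qed (simp_all add: g_def zero_prod_def fun_eq_iff)
  show "K \<subseteq> root_sublattice M"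
  proof
    fix v assume "v \<in> K"
    then obtain x y where v: "v = (x, y, 0)" "x \<in> root_lattice 9" "y \<in> root_lattice 9" "x 1 = 0" "x 2 = 0"
      unfolding K_def by auto
    have "x 0 = 0" using v(2) unfolding root_lattice_iff by simp
    then have x0: "x i = 0" if "i < 3" for i
      using that v(4,5) by (auto simp: numeral_3_eq_3 numeral_2_eq_2 less_Suc_eq)
    define a where "a = (\<lambda>i. if i = 0 then 0 else x (i + 2))"
    have "a \<in> root_lattice 7" using v(2) unfolding a_def root_lattice_iff by auto
    then have mem: "f a + g y \<in> group_closure ?R" by (intro group_closure_add f g v(3))
    have "(if i < 3 then 0 else a (i - 2)) = x i" for i
    proof (cases "i < 3")
      case False
      then have "i - 2 \<noteq> 0" "i - 2 + 2 = i" by linarith+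
      then show ?thesis using False unfolding a_def by (simp only: if_False)
    qed (simp add: x0)
    then have "f a = (x, 0, 0)" unfolding f_def by (simp only:)
    then have "v = f a + g y" unfolding v(1) g_def by simp
    then show "v \<in> root_sublattice M" using mem unfolding root_sublattice_def by simp
  qed
qed

lemma W_root_eq: "W_root = K" and N_root_eq: "N_root = K"
  using root_sublattice_eq_K K_subset_N K_subset_W N_subset_W by blast+

section \<open>Closure properties, orthogonal projection and the height form\<close>

lemma bform_diff_left: "bform (v - v') w = bform v w - bform v' w"
  by (cases v; cases v'; cases w) (simp add: form_A9_eq form_D6_eq algebra_simps)

lemma W_zero: "0 \<in> W" using K_zero K_subset_W by blast

lemma W_diff:
  assumes "v \<in> W" "w \<in> W" shows "v - w \<in> W"
  using assms unfolding W_def orth_compl_def L_def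
  by (auto simp: bform_diff_left intro: group_closure.diff)

lemma N_zero: "0 \<in> N" using K_zero K_subset_N by blast

lemma N_diff:
  assumes "v \<in> N" "w \<in> N" shows "v - w \<in> N"
  using assms unfolding N_eq L_root_def by (auto intro: W_diff root_lattice_diff)

lemma smul_zero [simp]: "smul c 0 = 0"
  by (simp add: smul_def fun_eq_iff)

lemma smul_apply: "smul c x i = c * x i"
  by (simp add: smul_def)

interpretation qv: vector_space qscale by (rule vector_space_qscale)

lemma qspan_K_D:
  assumes "v \<in> qspan K"
  obtains x y where "v = (x, y, 0)" "x 1 = 0" "x 2 = 0" "\<And>i. i \<notin> {1..9} \<Longrightarrow> x i = 0 \<and> y i = 0"
proof -
  let ?S = "{(x, y, z :: coords). z = 0 \<and> x 1 = 0 \<and> x 2 = 0 \<and> (\<forall>i. i \<notin> {1..9} \<longrightarrow> x i = 0 \<and> y i = 0)}"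
  have "qv.subspace ?S"
    by (rule qv.subspaceI) (auto simp: zero_prod_def smul_apply)
  moreover have "K \<subseteq> ?S" unfolding K_def root_lattice_iff by auto
  ultimately have "qspan K \<subseteq> ?S" unfolding qspan_def by (intro qv.span_minimal)
  then show ?thesis using assms that by blast
qed

text \<open>Testing against the simple roots gives the nonsingular Cartan systems of A_7 and A_9.
  This yields the uniqueness of the projection.\<close>

lemma qspan_K_nondegenerate:
  assumes "v \<in> qspan K" "\<And>r. r \<in> K \<Longrightarrow> bform v r = 0"
  shows "v = 0"
proof -
  obtain x y where v: "v = (x, y, 0)" "x 1 = 0" "x 2 = 0" "\<And>i. i \<notin> {1..9} \<Longrightarrow> x i = 0 \<and> y i = 0"
    by (rule qspan_K_D[OF assms(1)]) blast
  have "form_A 9 x (sroot k) = 0" if "k \<in> {3..9}" for k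
  proof -
    have "(sroot k, 0, 0) \<in> K" using that unfolding K_def root_lattice_iff by (auto simp: sroot_def)
    from assms(2)[OF this] show ?thesis unfolding v(1) by (simp add: form_A9_eq form_D6_eq)
  qed
  from this[of 3] this[of 4] this[of 5] this[of 6] this[of 7] this[of 8] this[of 9]
  have x: "x 3 = 0 \<and> x 4 = 0 \<and> x 5 = 0 \<and> x 6 = 0 \<and> x 7 = 0 \<and> x 8 = 0 \<and> x 9 = 0"
    using v(2,3) unfolding form_A9_eq by (simp add: sroot_def)
  have "form_A 9 y (sroot k) = 0" if "k \<in> {1..9}" for k
  proof -
    have "(0, sroot k, 0) \<in> K" using that unfolding K_def root_lattice_iff by (auto simp: sroot_def)
    from assms(2)[OF this] show ?thesis unfolding v(1) by (simp add: form_A9_eq form_D6_eq)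
  qed
  from this[of 1] this[of 2] this[of 3] this[of 4] this[of 5] this[of 6] this[of 7] this[of 8] this[of 9]
  have y: "y 1 = 0 \<and> y 2 = 0 \<and> y 3 = 0 \<and> y 4 = 0 \<and> y 5 = 0 \<and> y 6 = 0 \<and> y 7 = 0 \<and> y 8 = 0 \<and> y 9 = 0"
    unfolding form_A9_eq by (simp add: sroot_def)
  have "x i = 0 \<and> y i = 0" for i
  proof (cases "i \<in> {1..9}")
    case True
    then have "i \<in> {1, 2, 3, 4, 5, 6, 7, 8, 9}" unfolding one_to_nine .
    then show ?thesis using v(2,3) x y by (elim insertE) simp_all
  qed (rule v(4))
  then show ?thesis unfolding v(1) zero_prod_def by (auto simp: fun_eq_iff)
qed

text \<open>The coefficient list is \<open>-5 \<alpha>\<^sub>2\<close>, which spans the orthogonal complement of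
  \<open>a\<^sub>1, a\<^sub>3, \<dots>, a\<^sub>9\<close>.\<close>

definition mw_proj :: "vec3 \<Rightarrow> vec3" where
  "mw_proj w = (smul (cx w / 40) (coords_of [4, 8, 7, 6, 5, 4, 3, 2, 1]), 0, smul (cz w) delta6)"

text \<open>\<open>mw_proj w\<close> has the same coefficients at a_1 and a_2 and the same D_6 part
  as \<open>w\<close>, and the factor 40 clears all denominators, so 40 times the difference lies in
  \<open>K\<close> itself.\<close>

lemma diff_mw_proj:
  assumes "w \<in> W"
  obtains k where "k \<in> K" "w - mw_proj w = qscale (1/40) k"
proof -
  obtain x y z where w: "w = (x, y, z)" by (cases w)
  obtain p t where px: "x - smul (of_int (2 * p + 5 * t)) alpha \<in> root_lattice 9" and
    py: "y - smul (of_int (4 * p)) alpha \<in> root_lattice 9" and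
    z: "z = smul (of_int t) delta6" and x2: "x 2 = 2 * x 1" using W_D assms w by blast
  obtain m where m: "cx w = of_int m" using W_coords[OF assms] by blast
  let ?c = "coords_of [4, 8, 7, 6, 5, 4, 3, 2, 1]"
  have c: "?c i \<in> \<int>" for i
    by (auto simp: coords_of_def nth_Cons split: nat.split)
  have int: "40 * u i \<in> \<int>" if "u - smul (of_int k) alpha \<in> root_lattice 9" for u k i
  proof -
    have "40 * u i = of_int 40 * (u - smul (of_int k) alpha) i + of_int (10 * (4 * k)) * alpha i"
      by (simp add: smul_def algebra_simps)
    moreover have "(u - smul (of_int k) alpha) i \<in> \<int>" using that unfolding root_lattice_iff by blast
    ultimately show ?thesis using mult_alpha_Ints by (metis Ints_add Ints_mult Ints_of_int)
  qed
  have out: "u i = 0" if "u - smul (of_int k) alpha \<in> root_lattice 9" "i \<notin> {1..9}" for u k i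
    using that alpha_outside[OF that(2)] unfolding root_lattice_iff smul_def by auto
  let ?k = "(smul 40 x - smul (of_int m) ?c, smul 40 y, 0)"
  have "smul 40 y \<in> root_lattice 9"
    unfolding root_lattice_iff smul_def using int[OF py] out[OF py] by auto
  moreover have "smul 40 x - smul (of_int m) ?c \<in> root_lattice 9"
    unfolding root_lattice_iff smul_def using int[OF px] out[OF px] c
    by (auto simp: coords_of_def)
  moreover have "(smul 40 x - smul (of_int m) ?c) 1 = 0" "(smul 40 x - smul (of_int m) ?c) 2 = 0"
    using m x2 unfolding cx_def w by (simp_all add: smul_def coords_of_def)
  ultimately have "?k \<in> K" unfolding K_def by blast
  moreover have "cz w = of_int t" unfolding cz_def w z by (simp add: smul_def)
  then have "w - mw_proj w = qscale (1/40) ?k"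
    unfolding mw_proj_def m unfolding w z by (simp add: smul_def fun_eq_iff field_simps)
  ultimately show ?thesis by (rule that)
qed

text \<open>Two candidates for the projection differ by a vector of the span of \<open>K\<close>
  orthogonal to \<open>K\<close>, hence by zero.\<close>

lemma proj_eq:
  assumes "w \<in> W"
  shows "proj w = mw_proj w"
  unfolding proj_def W_root_eq
proof (rule the_equality)
  obtain k where k: "k \<in> K" "w - mw_proj w = qscale (1/40) k" using diff_mw_proj[OF assms] .
  have d: "w - mw_proj w \<in> qspan K"
    unfolding k(2) qspan_def by (intro qv.span_scale qv.span_base k(1))
  have "qscale (1/40) k \<in> qspan W" "w \<in> qspan W"
    using K_subset_W k(1) assms unfolding qspan_def by (auto intro: qv.span_scale qv.span_base)
  then have "w - qscale (1/40) k \<in> qspan W" unfolding qspan_def by (rule qv.span_diff[rotated])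
  moreover have "mw_proj w = w - qscale (1/40) k" unfolding k(2)[symmetric] by simp
  moreover have orth: "bform (mw_proj w) r = 0" if "r \<in> K" for r
  proof -
    obtain x y where r: "r = (x, y, 0)" "x 1 = 0" "x 2 = 0" using \<open>r \<in> K\<close> unfolding K_def by blast
    show ?thesis unfolding r(1) mw_proj_def bform.simps form_A9_eq form_D6_eq r(2,3)
      by (simp add: smul_def coords_of_def)
  qed
  ultimately show "mw_proj w \<in> qspan W \<and> (\<forall>r\<in>K. bform (mw_proj w) r = 0) \<and> w - mw_proj w \<in> qspan K"
    using d by simp
  fix p assume p: "p \<in> qspan W \<and> (\<forall>r\<in>K. bform p r = 0) \<and> w - p \<in> qspan K"
  have "(w - mw_proj w) - (w - p) \<in> qspan K" using d p unfolding qspan_def by (blast intro: qv.span_diff)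
  then have "p - mw_proj w \<in> qspan K" by simp
  then have "p - mw_proj w = 0"
    by (rule qspan_K_nondegenerate) (simp add: bform_diff_left p orth)
  then show "p = mw_proj w" by simp
qed

text \<open>The coefficient list in \<open>mw_proj\<close> has square -40 and \<open>delta6\<close>
  has square -3/2; they lie in orthogonal summands.\<close>

lemma bform_mw_proj: "- bform (mw_proj v) (mw_proj w) = (cx v * cx w + 60 * cz v * cz w) / 40"
  unfolding mw_proj_def bform.simps form_A9_eq form_D6_eq
  by (simp add: smul_def coords_of_def field_simps)

section \<open>Quotients of lattices as groups\<close>

text \<open>Translates between additive lattices and the multiplicatively written quotient groups.
  Here \<open>K\<close> is a parameter: the locale is used for \<open>W / K\<close>,
  \<open>W / N\<close> and \<open>N / K\<close>.\<close>

locale lattice_quotient =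
  fixes M K :: "vec3 set"
  assumes zero_mem: "0 \<in> K"
    and diff_K: "x \<in> K \<Longrightarrow> y \<in> K \<Longrightarrow> x - y \<in> K"
    and diff_M: "x \<in> M \<Longrightarrow> y \<in> M \<Longrightarrow> x - y \<in> M"
    and subset: "K \<subseteq> M"
begin

lemma zero_M: "0 \<in> M" using zero_mem subset by blast

lemma minus_K: "x \<in> K \<Longrightarrow> - x \<in> K" using diff_K[OF zero_mem, of x] by simp
lemma minus_M: "x \<in> M \<Longrightarrow> - x \<in> M" using diff_M[OF zero_M, of x] by simp
lemma add_K: "x \<in> K \<Longrightarrow> y \<in> K \<Longrightarrow> x + y \<in> K" using diff_K[of x "- y"] minus_K by simp
lemma add_M: "x \<in> M \<Longrightarrow> y \<in> M \<Longrightarrow> x + y \<in> M" using diff_M[of x "- y"] minus_M by simp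

lemma comm_group_add_grp: "comm_group (add_grp M)"
proof (rule comm_groupI)
  fix x assume "x \<in> carrier (add_grp M)"
  then show "\<exists>y\<in>carrier (add_grp M). y \<otimes>\<^bsub>add_grp M\<^esub> x = \<one>\<^bsub>add_grp M\<^esub>"
    by (intro bexI[of _ "- x"]) (auto simp: add_grp_def minus_M)
qed (auto simp: add_grp_def zero_M add_M algebra_simps)

lemma group_add_grp: "group (add_grp M)"
  using comm_group_add_grp unfolding comm_group_def by blast

lemma inv_add_grp: "x \<in> M \<Longrightarrow> inv\<^bsub>add_grp M\<^esub> x = - x"
  by (rule group.inv_equality[OF group_add_grp]) (auto simp: add_grp_def minus_M)

lemma subgroup_K: "subgroup K (add_grp M)"
proof (rule group.subgroupI[OF group_add_grp])
  fix x assume "x \<in> K"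
  then show "inv\<^bsub>add_grp M\<^esub> x \<in> K" using inv_add_grp minus_K subset by (metis subsetD)
qed (use subset zero_mem add_K in \<open>auto simp: add_grp_def\<close>)

lemma normal_K: "K \<lhd> add_grp M"
  using comm_group.normal_iff_subgroup[OF comm_group_add_grp] subgroup_K by blast

lemma coset_eq_image: "coset M K x = (\<lambda>k. k + x) ` K"
  unfolding coset_def r_coset_def add_grp_def by auto

lemma coset_eq_iff: "coset M K x = coset M K y \<longleftrightarrow> x - y \<in> K"
proof
  assume "coset M K x = coset M K y"
  moreover have "x \<in> coset M K x" unfolding coset_eq_image using zero_mem by force
  ultimately obtain k where "k \<in> K" "x = k + y" unfolding coset_eq_image by auto
  then show "x - y \<in> K" by simp
next
  assume d: "x - y \<in> K"
  have "k + x \<in> coset M K y" if "k \<in> K" for k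
    unfolding coset_eq_image by (rule image_eqI[of _ _ "k + (x - y)"]) (simp_all add: add_K that d)
  moreover have "k + y \<in> coset M K x" if "k \<in> K" for k
    unfolding coset_eq_image by (rule image_eqI[of _ _ "k - (x - y)"]) (simp_all add: diff_K that d)
  ultimately show "coset M K x = coset M K y" unfolding coset_eq_image by blast
qed

lemma carrier_quot: "carrier (quot M K) = coset M K ` M"
  unfolding quot_def FactGroup_def RCOSETS_def coset_def by (auto simp: add_grp_def)

lemma comm_group_quot: "comm_group (quot M K)"
  unfolding quot_def by (rule comm_group.abelian_FactGroup[OF comm_group_add_grp subgroup_K])

lemma group_quot: "group (quot M K)"
  using comm_group_quot unfolding comm_group_def by blast

lemma mult_coset:
  assumes "x \<in> M" "y \<in> M"
  shows "coset M K x \<otimes>\<^bsub>quot M K\<^esub> coset M K y = coset M K (x + y)"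
  using normal.rcos_sum[OF normal_K, of x y] assms
  unfolding quot_def FactGroup_def coset_def by (simp add: add_grp_def)

lemma one_quot: "\<one>\<^bsub>quot M K\<^esub> = coset M K 0"
  unfolding coset_eq_image quot_def FactGroup_def by simp

lemma inv_coset:
  assumes "x \<in> M"
  shows "inv\<^bsub>quot M K\<^esub> (coset M K x) = coset M K (- x)"
  by (rule group.inv_equality[OF group_quot])
    (use assms in \<open>auto simp: mult_coset one_quot carrier_quot minus_M\<close>)

lemma qscale_nat_M: "x \<in> M \<Longrightarrow> qscale (of_nat n) x \<in> M"
  by (induction n) (auto simp: zero_M add_M qv.scale_left_distrib)

lemma qscale_int_M:
  assumes "x \<in> M" shows "qscale (of_int n) x \<in> M"
proof (cases n rule: int_cases2)
  case (nonpos k)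
  then show ?thesis using minus_M[OF qscale_nat_M[OF assms, of k]] by simp
qed (simp add: qscale_nat_M assms)

lemma coset_nat_pow:
  assumes "x \<in> M"
  shows "coset M K x [^]\<^bsub>quot M K\<^esub> (n::nat) = coset M K (qscale (of_nat n) x)"
proof (induction n)
  case 0
  then show ?case by (simp add: one_quot)
next
  case (Suc n)
  then show ?case
    using assms by (simp add: mult_coset qscale_nat_M qv.scale_left_distrib add.commute)
qed

lemma coset_int_pow:
  assumes "x \<in> M"
  shows "coset M K x [^]\<^bsub>quot M K\<^esub> (n::int) = coset M K (qscale (of_int n) x)"
proof (cases n rule: int_cases2)
  case (nonneg k)
  then show ?thesis using coset_nat_pow[OF assms] by (simp add: int_pow_int)
next
  case (nonpos k)
  have "coset M K x \<in> carrier (quot M K)" using assms unfolding carrier_quot by blast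
  then show ?thesis
    using nonpos assms
    by (simp add: group.int_pow_neg[OF group_quot] int_pow_int coset_nat_pow inv_coset qscale_nat_M)
qed

lemma ord_coset:
  assumes "x \<in> M" "\<And>k. qscale (of_nat k) x \<in> K \<longleftrightarrow> n dvd k"
  shows "group.ord (quot M K) (coset M K x) = n"
proof -
  have "coset M K x \<in> carrier (quot M K)" using assms(1) unfolding carrier_quot by blast
  then have "group.ord (quot M K) (coset M K x) dvd k \<longleftrightarrow> n dvd k" for k
    using group.pow_eq_id[OF group_quot, of "coset M K x" k] assms
    by (simp add: coset_nat_pow one_quot coset_eq_iff)
  then show ?thesis by (meson dvd_antisym dvd_refl)
qed

lemma subgroup_coset_image:
  assumes "lattice_quotient M' K" "M' \<subseteq> M"
  shows "subgroup (coset M K ` M') (quot M K)"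
proof -
  interpret M': lattice_quotient M' K by (rule assms(1))
  show ?thesis
  proof (rule group.subgroupI[OF group_quot])
    show "coset M K ` M' \<subseteq> carrier (quot M K)" unfolding carrier_quot using assms(2) by (rule image_mono)
    show "coset M K ` M' \<noteq> {}" using M'.zero_M by blast
  next
    fix X assume "X \<in> coset M K ` M'"
    then obtain x where x: "x \<in> M'" "X = coset M K x" by blast
    then have "inv\<^bsub>quot M K\<^esub> X = coset M K (- x)" using inv_coset assms(2) by blast
    then show "inv\<^bsub>quot M K\<^esub> X \<in> coset M K ` M'" using M'.minus_M x(1) by blast
  next
    fix X Y assume "X \<in> coset M K ` M'" "Y \<in> coset M K ` M'"
    then obtain x y where xy: "x \<in> M'" "X = coset M K x" "y \<in> M'" "Y = coset M K y" by blast
    then have "X \<otimes>\<^bsub>quot M K\<^esub> Y = coset M K (x + y)" using mult_coset assms(2) by blast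
    then show "X \<otimes>\<^bsub>quot M K\<^esub> Y \<in> coset M K ` M'" using M'.add_M xy(1,3) by blast
  qed
qed

text \<open>The intermediate \<open>M'\<close> lets one statement serve both generation of all of
  \<open>W / K\<close> and generation of its subgroup \<open>N / K\<close>.\<close>

lemma generate_coset_pair:
  assumes "lattice_quotient M' K" "M' \<subseteq> M" "a \<in> M'" "b \<in> M'"
    and span: "\<And>v. v \<in> M' \<Longrightarrow> \<exists>i j::int. v - (qscale (of_int i) a + qscale (of_int j) b) \<in> K"
  shows "generate (quot M K) {coset M K a, coset M K b} = coset M K ` M'" (is "?G = _")
proof
  show "?G \<subseteq> coset M K ` M'"
    using assms(3,4)
    by (intro group.generate_subgroup_incl[OF group_quot _ subgroup_coset_image[OF assms(1,2)]]) auto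
  show "coset M K ` M' \<subseteq> ?G"
  proof
    fix X assume "X \<in> coset M K ` M'"
    then obtain v where v: "v \<in> M'" "X = coset M K v" by blast
    obtain i j :: int where ij: "v - (qscale (of_int i) a + qscale (of_int j) b) \<in> K" using span[OF v(1)] by blast
    have ab: "a \<in> M" "b \<in> M" using assms(2-4) by auto
    have sub: "subgroup ?G (quot M K)"
      using ab by (intro group.generate_is_subgroup[OF group_quot]) (auto simp: carrier_quot)
    have "X = coset M K (qscale (of_int i) a + qscale (of_int j) b)"
      unfolding v(2) coset_eq_iff by (rule ij)
    also have "\<dots> = coset M K a [^]\<^bsub>quot M K\<^esub> i \<otimes>\<^bsub>quot M K\<^esub> coset M K b [^]\<^bsub>quot M K\<^esub> j"
      using ab by (simp add: coset_int_pow mult_coset qscale_int_M)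
    also have "\<dots> \<in> ?G"
      by (intro subgroup.m_closed[OF sub] group.subgroup_int_pow_closed[OF group_quot sub] generate.incl) simp_all
    finally show "X \<in> ?G" .
  qed
qed

end

interpretation MW: lattice_quotient W K
  by unfold_locales (use K_zero K_diff W_diff K_subset_W in auto)

interpretation W_mod_N: lattice_quotient W N
  by unfold_locales (use N_zero N_diff W_diff N_subset_W in auto)

interpretation N_mod_K: lattice_quotient N K
  by unfold_locales (use K_zero K_diff N_diff K_subset_N in auto)

text \<open>A coset of \<open>K\<close> is the same set in either ambient group, so
  \<open>N / K\<close> lies literally inside \<open>W / K\<close>.\<close>

lemma carrier_quot_N_K: "carrier (quot N K) = coset W K ` N"
  unfolding N_mod_K.carrier_quot N_mod_K.coset_eq_image MW.coset_eq_image ..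

section \<open>Heights and coordinates of the sections\<close>

text \<open>\<open>cx\<close> and \<open>cz\<close> vanish on \<open>K\<close>, hence are constant
  on cosets, and the set of values defining the pairing is a singleton.\<close>

lemma height_pairing_eq:
  assumes "v \<in> W" "w \<in> W"
  shows "height_pairing (coset W K v) (coset W K w) = (cx v * cx w + 60 * cz v * cz w) / 40"
proof -
  have rep: "u' \<in> W \<and> cx u' = cx u \<and> cz u' = cz u" if "u' \<in> coset W K u" "u \<in> W" for u u'
  proof -
    obtain k where k: "k \<in> K" "u' = k + u" using \<open>u' \<in> coset W K u\<close> unfolding MW.coset_eq_image by blast
    then have "cx k = 0" "cz k = 0" using mem_K_iff K_subset_W by blast+
    moreover have "u' \<in> W" unfolding k(2) using k(1) that(2) K_subset_W by (blast intro: MW.add_M)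
    ultimately show ?thesis unfolding k(2) by (simp add: cx_cz_linear)
  qed
  have self: "u \<in> coset W K u" for u unfolding MW.coset_eq_image using K_zero by force
  have val: "- bform (proj v') (proj w') = (cx v * cx w + 60 * cz v * cz w) / 40"
    if "v' \<in> coset W K v" "w' \<in> coset W K w" for v' w'
    using rep[OF that(1) assms(1)] rep[OF that(2) assms(2)] by (simp add: proj_eq bform_mw_proj)
  have "{- bform (proj v') (proj w') | v' w'. v' \<in> coset W K v \<and> w' \<in> coset W K w}
      = {(cx v * cx w + 60 * cz v * cz w) / 40}"
    using val val[OF self self, symmetric] self by blast
  then show ?thesis unfolding height_pairing_def by simp
qed

text \<open>The glue gives V_j the first coordinate -j for j < 9; adding a_1 + a_2 turns -9 into 1
  for \<open>V9\<close>.\<close>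

lemma frame_coords:
  "frame_part V1 \<in> W" "cx (frame_part V1) = - 1" "cz (frame_part V1) = 1"
  "frame_part V2 \<in> W" "cx (frame_part V2) = - 2" "cz (frame_part V2) = 0"
  "frame_part V3 \<in> W" "cx (frame_part V3) = - 3" "cz (frame_part V3) = 1"
  "frame_part V5 \<in> W" "cx (frame_part V5) = - 5" "cz (frame_part V5) = 1"
  "frame_part V7 \<in> W" "cx (frame_part V7) = - 7" "cz (frame_part V7) = 1"
  "frame_part V9 \<in> W" "cx (frame_part V9) = 1" "cz (frame_part V9) = 1"
  "frame_part V11 \<in> W" "cx (frame_part V11) = 10" "cz (frame_part V11) = 0"
  "frame_part V12 \<in> W" "cx (frame_part V12) = 0" "cz (frame_part V12) = 2"
proof -
  have "frame_part S \<in> W" if "S \<in> {V1, V2, V3, V4, V5, V6, V7, V8, V9, V11, V12}" for S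
  proof -
    have "S \<in> NS" using sections that by blast
    then show ?thesis unfolding NS_def frame_part_def by auto
  qed
  then show "frame_part V1 \<in> W" "frame_part V2 \<in> W" "frame_part V3 \<in> W" "frame_part V5 \<in> W"
    "frame_part V7 \<in> W" "frame_part V9 \<in> W" "frame_part V11 \<in> W" "frame_part V12 \<in> W"
    by simp_all
qed (simp_all add: V1_def V2_def V3_def V5_def V7_def V9_def V11_def V12_def section_class_def
    frame_part_def cx_def cz_def alpha_dual_eq sroot_def smul_def)

section \<open>The index of \<open>N\<close> in \<open>W\<close> and orders modulo
  \<open>N\<close>\<close>

lemma card_rcosets_N:
  "card (rcosets\<^bsub>quot W K\<^esub> (carrier (quot N K))) = 10"
proof -
  \<comment> \<open>With coordinates (-1, 1), the class of \<open>V1\<close> generates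
    \<open>W / N\<close>; its multiples from 0 to 9 represent the ten cosets.\<close>
  define w where "w = frame_part V1"
  have w: "w \<in> W" "cx w = -1" "cz w = 1" unfolding w_def by (rule frame_coords)+
  let ?R = "\<lambda>v. carrier (quot N K) #>\<^bsub>quot W K\<^esub> coset W K v"
  \<comment> \<open>A coset of \<open>N / K\<close> in \<open>W / K\<close> collects the
    \<open>K\<close>-cosets inside the translate of \<open>N\<close> by \<open>v\<close>, so the
    index is that of \<open>N\<close> in \<open>W\<close>.\<close>
  have R: "?R v = coset W K ` (\<lambda>n. n + v) ` N" if "v \<in> W" for v
    unfolding r_coset_def carrier_quot_N_K using that N_subset_W by (force simp: MW.mult_coset subset_iff)
  have R_eq: "?R v = ?R u \<longleftrightarrow> v - u \<in> N" if "v \<in> W" "u \<in> W" for v u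
  proof
    assume "?R v = ?R u"
    moreover have "coset W K v \<in> ?R v" unfolding R[OF \<open>v \<in> W\<close>] using N_zero by force
    ultimately obtain n where n: "n \<in> N" "coset W K v = coset W K (n + u)"
      unfolding R[OF \<open>u \<in> W\<close>] by auto
    then have "v - (n + u) \<in> N" using MW.coset_eq_iff K_subset_N by blast
    from N_mod_K.add_M[OF this n(1)] show "v - u \<in> N" by simp
  next
    assume d: "v - u \<in> N"
    have "(\<lambda>n. n + v) ` N = (\<lambda>n. n + u) ` N"
      using W_mod_N.coset_eq_iff[of v u] d unfolding W_mod_N.coset_eq_image by blast
    then show "?R v = ?R u" unfolding R[OF that(1)] R[OF that(2)] by simp
  qed
  let ?w = "\<lambda>k::nat. qscale (of_nat k) w"
  have wW: "?w k \<in> W" for k using MW.qscale_nat_M w(1) by blast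
  have "rcosets\<^bsub>quot W K\<^esub> (carrier (quot N K)) = ?R ` W"
    unfolding RCOSETS_def MW.carrier_quot by auto
  also have "\<dots> = (\<lambda>k. ?R (?w k)) ` {0..<10}"
  proof
    show "(\<lambda>k. ?R (?w k)) ` {0..<10} \<subseteq> ?R ` W" using wW by blast
    show "?R ` W \<subseteq> (\<lambda>k. ?R (?w k)) ` {0..<10}"
    proof
      fix X assume "X \<in> ?R ` W"
      then obtain v where v: "v \<in> W" "X = ?R v" by blast
      obtain m t where mt: "cx v = of_int m" "cz v = of_int t" "even (m - t)" using W_coords[OF v(1)] .
      \<comment> \<open>The sign reflects \<open>cx w = -1\<close>. Once \<open>m + int k\<close> is
        divisible by 10, equal parity of \<open>m\<close> and \<open>t\<close> makes
        \<open>t - int k\<close> even.\<close>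
      define k where "k = nat ((- m) mod 10)"
      have k: "int k = (- m) mod 10" unfolding k_def by simp
      define a where "a = (- m) div 10"
      have m: "m + int k = 10 * (- a)" unfolding k a_def using mult_div_mod_eq[of 10 "- m"] by linarith
      obtain b where b: "m - t = 2 * b" using mt(3) by blast
      have t: "t - int k = 2 * (m - b + 5 * a)" using m b by simp
      have "v - ?w k \<in> N"
      proof (subst mem_N_iff)
        show "v - ?w k \<in> W" using W_diff v(1) wW by blast
        have "cx (v - ?w k) = of_int (m + int k)" "cz (v - ?w k) = of_int (t - int k)"
          using mt w by (simp_all add: cx_cz_linear)
        then show "\<exists>a b::int. cx (v - ?w k) = of_int (10 * a) \<and> cz (v - ?w k) = of_int (2 * b)"
          unfolding m t by blast
      qed
      then have "X = ?R (?w k)" unfolding v(2) using R_eq v(1) wW by blast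
      moreover have "k \<in> {0..<10}" unfolding k_def by (simp add: nat_less_iff)
      ultimately show "X \<in> (\<lambda>k. ?R (?w k)) ` {0..<10}" by blast
    qed
  qed
  also have "card \<dots> = 10"
  proof -
    have "inj_on (\<lambda>k. ?R (?w k)) {0..<10}"
    proof (rule inj_onI)
      fix k l :: nat assume kl: "k \<in> {0..<10}" "l \<in> {0..<10}" "?R (?w k) = ?R (?w l)"
      then have "?w k - ?w l \<in> N" using R_eq wW by blast
      then obtain a where "cx (?w k - ?w l) = of_int (10 * a)" using mem_N_iff W_diff wW by blast
      then have "(of_int (int l - int k) :: rat) = of_int (10 * a)" using w by (simp add: cx_cz_linear)
      then have "int l - int k = 10 * a" by (simp only: of_int_eq_iff)
      moreover from this have "a = 0" using kl(1,2) by simp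
      ultimately show "k = l" by simp
    qed
    then show ?thesis by (simp add: card_image)
  qed
  finally show ?thesis .
qed

lemma ord_mod_N:
  assumes "S \<in> {V1, V3, V7, V9}"
  shows "group.ord (quot W N) (coset W N (frame_part S)) = 10"
proof (rule W_mod_N.ord_coset)
  \<comment> \<open>\<open>n\<close> is an inverse of \<open>m\<close> modulo 10: the first
    coordinate alone then forces 10 to divide \<open>k\<close>.\<close>
  obtain m n :: int where S: "frame_part S \<in> W" "cz (frame_part S) = 1" "cx (frame_part S) = of_int m"
    "m * n = 10 * ((m * n - 1) div 10) + 1"
  proof -
    have "cx (frame_part V1) = of_int (- 1)" "cx (frame_part V3) = of_int (- 3)"
      "cx (frame_part V7) = of_int (- 7)" "cx (frame_part V9) = of_int 1" by (simp_all add: frame_coords)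
    then show ?thesis using assms that[of "-1" 9] that[of "-3" 3] that[of "-7" 7] that[of 1 1]
      by (auto simp: frame_coords)
  qed
  show "frame_part S \<in> W" by (rule S(1))
  fix k :: nat
  have W: "qscale (of_nat k) (frame_part S) \<in> W" using MW.qscale_nat_M S(1) .
  have c: "cx (qscale (of_nat k) (frame_part S)) = of_int (int k * m)"
    "cz (qscale (of_nat k) (frame_part S)) = of_int (int k)" using S by (simp_all add: cx_cz_linear)
  show "qscale (of_nat k) (frame_part S) \<in> N \<longleftrightarrow> 10 dvd k"
    unfolding mem_N_iff[OF W] c of_int_eq_iff
  proof
    assume "\<exists>a b. int k * m = 10 * a \<and> int k = 2 * b"
    then obtain a where a: "int k * m = 10 * a" by blast
    have "int k * (m * n) = 10 * (a * n)" using a by (metis mult.assoc)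
    then have "int k = 10 * (a * n - int k * ((m * n - 1) div 10))"
      by (subst (asm) S(4)) (simp add: algebra_simps)
    then have "int 10 dvd int k" by (metis dvd_triv_left of_nat_numeral)
    then show "10 dvd k" by (simp only: int_dvd_int_iff)
  next
    assume "10 dvd k"
    then obtain l where l: "k = 10 * l" by blast
    show "\<exists>a b. int k * m = 10 * a \<and> int k = 2 * b"
      by (rule exI[of _ "int l * m"], rule exI[of _ "5 * int l"]) (simp add: l)
  qed
qed

text \<open>For the coordinates (-5, 1) both conditions of \<open>mem_N_iff\<close> on a multiple
  say that the multiplier is even.\<close>

lemma ord_mod_N_V5: "group.ord (quot W N) (coset W N (frame_part V5)) = 2"
proof (rule W_mod_N.ord_coset)
  show V5: "frame_part V5 \<in> W" by (rule frame_coords)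
  fix k :: nat
  have W: "qscale (of_nat k) (frame_part V5) \<in> W" using MW.qscale_nat_M V5 .
  have c: "cx (qscale (of_nat k) (frame_part V5)) = of_int (- 5 * int k)"
    "cz (qscale (of_nat k) (frame_part V5)) = of_int (int k)" by (simp_all add: cx_cz_linear frame_coords)
  show "qscale (of_nat k) (frame_part V5) \<in> N \<longleftrightarrow> 2 dvd k"
    unfolding mem_N_iff[OF W] c of_int_eq_iff
  proof
    assume "\<exists>a b. - 5 * int k = 10 * a \<and> int k = 2 * b"
    then have "int 2 dvd int k" by (metis dvd_triv_left of_nat_numeral)
    then show "2 dvd k" by (simp only: int_dvd_int_iff)
  next
    assume "2 dvd k"
    then obtain l where l: "k = 2 * l" by blast
    show "\<exists>a b. - 5 * int k = 10 * a \<and> int k = 2 * b"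
      by (rule exI[of _ "- int l"], rule exI[of _ "int l"]) (simp add: l)
  qed
qed

lemma mw_eq: "mw S = coset W K (frame_part S)"
  unfolding mw_def W_root_eq ..

lemma MW_eq: "MW = quot W K"
  unfolding MW_def W_root_eq ..

section \<open>Pairs of generators and their height forms\<close>

text \<open>Pairs of equal parity form a sublattice of index 2 in the integer plane, so a basis of
  it has determinant 2 or -2; \<open>e\<close> is the sign.\<close>

locale mw_basis =
  fixes P R :: ns_class and m t m' t' e :: int
  assumes P: "frame_part P \<in> W" "cx (frame_part P) = of_int m" "cz (frame_part P) = of_int t"
    and R: "frame_part R \<in> W" "cx (frame_part R) = of_int m'" "cz (frame_part R) = of_int t'"
    and det: "m * t' - m' * t = 2 * e" and unit: "e * e = 1"
begin

lemma parity: "even (m - t)" "even (m' - t')"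
proof -
  obtain a b :: int where "cx (frame_part P) = of_int a" "cz (frame_part P) = of_int b" "even (a - b)"
    using W_coords[OF P(1)] .
  then show "even (m - t)" using P by simp
  obtain a b :: int where "cx (frame_part R) = of_int a" "cz (frame_part R) = of_int b" "even (a - b)"
    using W_coords[OF R(1)] .
  then show "even (m' - t')" using R by simp
qed

lemma generate_MW: "generate MW {mw P, mw R} = carrier MW"
  unfolding mw_eq MW_eq MW.carrier_quot
proof (rule MW.generate_coset_pair[OF MW.lattice_quotient_axioms order_refl P(1) R(1)])
  fix v assume v: "v \<in> W"
  obtain a b where ab: "cx v = of_int a" "cz v = of_int b" "even (a - b)" using W_coords[OF v] .
  obtain u where u: "m - t = 2 * u" using parity by blast
  obtain u' where u': "m' - t' = 2 * u'" using parity by blast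
  obtain c where c: "a - b = 2 * c" using ab(3) by blast
  \<comment> \<open>Cramer's rule in the coordinates (t, u) with m = t + 2u, in which the
    equal-parity lattice becomes the full integer plane; the determinant \<open>e\<close> is its own
    inverse.\<close>
  define i where "i = e * (c * t' - b * u')"
  define j where "j = e * (b * u - c * t)"
  have mm: "m = t + 2 * u" "m' = t' + 2 * u'" "a = b + 2 * c" using u u' c by simp_all
  have e: "e = u * t' - u' * t" using det unfolding mm by (simp add: algebra_simps)
  have "(c * t' - b * u') * m + (b * u - c * t) * m' = (u * t' - u' * t) * a"
    "(c * t' - b * u') * t + (b * u - c * t) * t' = (u * t' - u' * t) * b"
    unfolding mm by (simp_all add: algebra_simps)
  then have "i * m + j * m' = e * (e * a)" "i * t + j * t' = e * (e * b)"
    unfolding e[symmetric] i_def j_def by (simp_all only: mult.assoc distrib_left[symmetric])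
  then have ij: "i * m + j * m' = a" "i * t + j * t' = b"
    by (simp_all add: unit mult.assoc[symmetric])
  let ?d = "v - (qscale (of_int i) (frame_part P) + qscale (of_int j) (frame_part R))"
  have "cx ?d = of_int (a - (i * m + j * m'))" "cz ?d = of_int (b - (i * t + j * t'))"
    using P R ab by (simp_all add: cx_cz_linear)
  then have "cx ?d = 0" "cz ?d = 0" unfolding ij by simp_all
  moreover have "?d \<in> W"
    by (intro W_diff[OF v] MW.add_M MW.qscale_int_M P R)
  ultimately show "\<exists>i j::int. v - (qscale (of_int i) (frame_part P) + qscale (of_int j) (frame_part R)) \<in> K"
    using mem_K_iff by blast
qed

lemma quadratic_form_height_matrix:
  "quadratic_form (height_matrix P R) v =
    ((of_int m * v $ 1 + of_int m' * v $ 2)^2 + 60 * (of_int t * v $ 1 + of_int t' * v $ 2)^2) / 40"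
  unfolding quadratic_form_def height_matrix_def mw_eq
  by (simp add: sum_2 height_pairing_eq P R field_simps power2_eq_square)

text \<open>\<open>?M\<close> is chosen so that \<open>P, R\<close> combined with coefficients \<open>?M (x, y)\<close> have coordinates
  \<open>(x + 2 y, x)\<close>.\<close>

lemma GL2Z_equivalent_form_Q: "GL2Z_equivalent (quadratic_form (height_matrix P R)) form_Q"
proof -
  obtain u where u: "m - t = 2 * u" using parity by blast
  obtain u' where u': "m' - t' = 2 * u'" using parity by blast
  have mm: "m = t + 2 * u" "m' = t' + 2 * u'" using u u' by simp_all
  have e: "e = u * t' - u' * t" using det unfolding mm by (simp add: algebra_simps)
  let ?M = "vector [vector [- e * u', e * t'], vector [e * u, - e * t]] :: int^2^2"
  \<comment> \<open>\<open>?M'\<close> maps coefficients with respect to \<open>P\<close>,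
    \<open>R\<close> to the coordinates (t, u). There the target (x + 2y, x) reads (x, y), so
    \<open>?M\<close> is simply its inverse.\<close>
  let ?M' = "vector [vector [t, t'], vector [u, u']] :: int^2^2"
  have "e * e = e * (u * t' - u' * t)" unfolding e[symmetric] ..
  then have ee: "e * (u * t') - e * (u' * t) = 1" unfolding unit by (simp add: algebra_simps)
  have "?M ** ?M' = mat 1" "?M' ** ?M = mat 1"
    using ee by (simp_all add: vec_eq_iff forall_2 matrix_matrix_mult_def sum_2 mat_def algebra_simps)
  then have "invertible ?M" unfolding invertible_def by blast
  moreover have "form_Q v = quadratic_form (height_matrix P R) (map_matrix rat_of_int ?M *v v)" for v
  proof -
    let ?x = "v $ 1" and ?y = "v $ 2"
    have Mv: "(map_matrix rat_of_int ?M *v v) $ 1 = of_int e * (of_int t' * ?y - of_int u' * ?x)"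
      "(map_matrix rat_of_int ?M *v v) $ 2 = of_int e * (of_int u * ?x - of_int t * ?y)"
      by (simp_all add: matrix_vector_mult_def sum_2 map_matrix_def algebra_simps)
    have 1: "of_int t * (of_int e * (of_int t' * ?y - of_int u' * ?x))
        + of_int t' * (of_int e * (of_int u * ?x - of_int t * ?y))
        = of_int (e * (u * t') - e * (u' * t)) * ?x"
      by (simp add: algebra_simps)
    have 2: "of_int m * (of_int e * (of_int t' * ?y - of_int u' * ?x))
        + of_int m' * (of_int e * (of_int u * ?x - of_int t * ?y))
        = of_int (e * (u * t') - e * (u' * t)) * (?x + 2 * ?y)"
      unfolding mm by (simp add: algebra_simps)
    show ?thesis
      unfolding quadratic_form_height_matrix Mv 1 2 ee form_Q_def
      by (simp add: field_simps power2_eq_square)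
  qed
  ultimately show ?thesis unfolding GL2Z_equivalent_def by blast
qed

end

section \<open>Generators of \<open>N / K\<close> and conclusion\<close>

text \<open>\<open>V11\<close> and \<open>V12\<close> have coordinates (10, 0) and (0, 2), the
  obvious basis of the image of \<open>N\<close>.\<close>

lemma generate_N_mod_K:
  "generate (quot W K) {coset W K (frame_part V11), coset W K (frame_part V12)} = coset W K ` N"
proof (rule MW.generate_coset_pair[OF N_mod_K.lattice_quotient_axioms N_subset_W])
  show "frame_part V11 \<in> N"
    by (subst mem_N_iff) (auto simp: frame_coords intro!: exI[of _ "1::int"] exI[of _ "0::int"])
  show "frame_part V12 \<in> N"
    by (subst mem_N_iff) (auto simp: frame_coords intro!: exI[of _ "1::int"] exI[of _ "0::int"])
  fix v assume "v \<in> N"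
  then have v: "v \<in> W" using N_subset_W by blast
  then obtain a b :: int where ab: "cx v = of_int (10 * a)" "cz v = of_int (2 * b)"
    using mem_N_iff \<open>v \<in> N\<close> by blast
  let ?d = "v - (qscale (of_int a) (frame_part V11) + qscale (of_int b) (frame_part V12))"
  have "cx ?d = 0" "cz ?d = 0" using ab by (simp_all add: cx_cz_linear frame_coords)
  moreover have "?d \<in> W"
    by (intro W_diff[OF v] MW.add_M MW.qscale_int_M frame_coords)
  ultimately show "\<exists>i j::int. v - (qscale (of_int i) (frame_part V11) + qscale (of_int j) (frame_part V12)) \<in> K"
    using mem_K_iff by blast
qed

lemma V11_eq: "mw V11 = mw V2 [^]\<^bsub>MW\<^esub> (- 5 :: int)"
proof -
  have "frame_part V11 - qscale (of_int (- 5)) (frame_part V2) \<in> K"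
    by (subst mem_K_iff)
      (auto simp: cx_cz_linear frame_coords simp del: of_int_minus intro!: W_diff MW.qscale_int_M)
  then show ?thesis
    unfolding mw_eq MW_eq by (subst MW.coset_int_pow) (simp_all add: frame_coords MW.coset_eq_iff)
qed

theorem theorem2:
  shows
    "((\<forall>S\<in>{V1, V3, V7, V9, V5}. generate MW {mw V2, mw S} = carrier MW) \<and>
      (\<forall>S\<in>{V1, V3, V7, V9}. group.ord (quot W N) (coset W N (frame_part S)) = 10) \<and>
      group.ord (quot W N) (coset W N (frame_part V5)) = 2 \<and>
      generate MW {mw V1, mw V3} = carrier MW \<and>
      generate MW {mw V1, mw V9} = carrier MW)
   \<and> (\<forall>(P, R)\<in>{(V2, V1), (V2, V3), (V2, V7), (V2, V9), (V2, V5), (V1, V3), (V1, V9)}.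
        GL2Z_equivalent (quadratic_form (height_matrix P R)) form_Q)
   \<and> (subgroup (carrier (quot N N_root)) (quot W N_root) \<and>
      card (rcosets\<^bsub>quot W N_root\<^esub> (carrier (quot N N_root))) = 10 \<and>
      generate (quot W N_root) {coset W N_root (frame_part V11), coset W N_root (frame_part V12)}
        = carrier (quot N N_root) \<and>
      mw V11 = mw V2 [^]\<^bsub>MW\<^esub> (- 5 :: int) \<and>
      height_pairing (mw V11) (mw V12) = 0)"
proof -
  note [simp] = frame_coords
  \<comment> \<open>Since \<open>V2\<close> has coordinates (-2, 0), any class with second
    coordinate 1 gives determinant -2. The pairs of \<open>V1\<close> with \<open>V3\<close> and
    \<open>V9\<close> have determinants 2 and -2.\<close>
  interpret V21: mw_basis V2 V1 "- 2" 0 "- 1" 1 "- 1" by unfold_locales simp_all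
  interpret V23: mw_basis V2 V3 "- 2" 0 "- 3" 1 "- 1" by unfold_locales simp_all
  interpret V27: mw_basis V2 V7 "- 2" 0 "- 7" 1 "- 1" by unfold_locales simp_all
  interpret V29: mw_basis V2 V9 "- 2" 0 1 1 "- 1" by unfold_locales simp_all
  interpret V25: mw_basis V2 V5 "- 2" 0 "- 5" 1 "- 1" by unfold_locales simp_all
  interpret V13: mw_basis V1 V3 "- 1" 1 "- 3" 1 1 by unfold_locales simp_all
  interpret V19: mw_basis V1 V9 "- 1" 1 1 1 "- 1" by unfold_locales simp_all
  note gens = V21.generate_MW V23.generate_MW V27.generate_MW V29.generate_MW V25.generate_MW
    V13.generate_MW V19.generate_MW
  note forms = V21.GL2Z_equivalent_form_Q V23.GL2Z_equivalent_form_Q V27.GL2Z_equivalent_form_Q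
    V29.GL2Z_equivalent_form_Q V25.GL2Z_equivalent_form_Q V13.GL2Z_equivalent_form_Q
    V19.GL2Z_equivalent_form_Q
  have sub: "subgroup (carrier (quot N K)) (quot W K)"
    unfolding carrier_quot_N_K
    by (rule MW.subgroup_coset_image[OF N_mod_K.lattice_quotient_axioms N_subset_W])
  have height: "height_pairing (mw V11) (mw V12) = 0"
    unfolding mw_eq by (simp add: height_pairing_eq)
  show ?thesis
    unfolding N_root_eq
    using gens forms ord_mod_N ord_mod_N_V5 sub card_rcosets_N V11_eq height
      generate_N_mod_K[folded carrier_quot_N_K]
    by simp
qed

end
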